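(* Let $n\in\mathbb N$ and let $\mu^0\in\mathbb R^N_{\ge0}$ with $\partial^\circ E_n(\mu^0)\ne0$. There exists a unique locally absolutely continuous and a.e. differentiable curve $[0,+\infty)\ni t\mapsto\mu(t)\in\mathbb R^N_{\ge0}$ with $\mu(0)=\mu^0$ that is an energy solution of the gradient flow $\frac{d}{dt}\mu=-\partial^\circ E_n(\mu)$, i.e. $$E_n(\mu(t))=E_n(\mu^0)-\int_0^t\|\partial^\circ E_n(\mu(s))\|^2ds\qquad\forall t>0.$$ In particular, $\mu'(t)=-\partial^\circ E_n(\mu(t))$ for almost every $t>0$. Moreover, for any $\mu^0\in\mathbb R^N_{\ge0}$ with $\partial^\circ E_n(\mu^0)\neq0$, the limit of the corresponding curve as $t\to+\infty$ satisfies $$\lim_{t\to+\infty}\mu(t)\in\operatorname{argmin}_{\mathbb R^N_{\ge0}}E_n.$$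
   Context: Let $\Omega=(0,1)^d$ and let $f\in L^\infty(\Omega)$ satisfy $\int_\Omega f\,dx=0$ and $\operatorname{conv}(\operatorname{supp} f)\subset\subset\Omega$. $(\mathcal T^n)_{n\in\mathbb N}$ is a sequence of nested simplicial triangulations of $\Omega$ obtained by successive uniform refinements, $\mathcal T^n=\{T^n_1,\dots,T^n_N\}$ ($N$ depends on $n$). $\mathcal W_n$ is the space of continuous functions on $\Omega$, affine on each simplex of $\mathcal T^{n+1}$, with zero integral over $\Omega$; $\phi_1,\dots,\phi_M$ is a basis of it. $(\delta_n)$ is a monotone sequence of positive reals with $\delta_n\downarrow0$. Put $A^{(i)}=\left(\int_{T_i^n}\nabla\phi_p\cdot\nabla\phi_q\,dx\right)_{p,q}$, $A(\mu)=\sum_{i=1}^N(\mu_i+\delta_n)A^{(i)}$, $\boldsymbol f=\left(\int_\Omega f\phi_p\,dx\right)_p$, $a=(|T_1^n|,\dots,|T_N^n|)$. The functional $E_n$ is $E_n(\mu)=\boldsymbol f^{\,t}A(\mu)^{-1}\boldsymbol f+\langle\mu,a\rangle$ for $\mu\in\mathbb R^N_{\ge0}$, and $+\infty$ otherwise; it is convex on $\mathbb R^N$. $\partial^\circ E_n(\mu)$ denotes the unique element of minimal Euclidean norm of the convex subdifferential $\partial E_n(\mu)$, and $\|\cdot\|$ is the Euclidean norm.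
   Formalization: An energy solution is required to satisfy μ'(t) = -∂°E_n(μ(t)) for a.e. t as well as the energy identity, so uniqueness is among such curves; the identity alone does not force uniqueness or the flow equation (e.g. f = 0, N ≥ 2, adding an early loop orthogonal to a). *)

theory Defs
  imports "HOL-Analysis.Analysis"
begin

section \<open>Domain and data\<close>

definition Omega :: "(real ^ 'd) set"
  where "Omega = box 0 1"

text \<open>The support of a class of functions modulo null sets: the complement in \<open>Omega\<close> of the
  largest open set on which the function vanishes almost everywhere.\<close>

definition ess_support :: "(real ^ 'd \<Rightarrow> real) \<Rightarrow> (real ^ 'd) set"
  where "ess_support f =
    {x \<in> Omega. \<forall>U. open U \<longrightarrow> x \<in> U \<longrightarrow> \<not> (AE y in lebesgue. y \<in> U \<inter> Omega \<longrightarrow> f y = 0)}"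

definition compactly_contained :: "'a::topological_space set \<Rightarrow> 'a set \<Rightarrow> bool"
  where "compactly_contained A B \<longleftrightarrow> compact (closure A) \<and> closure A \<subseteq> B"

section \<open>Triangulations\<close>

text \<open>Simplices are closed and full-dimensional, and the library's \<open>triangulation\<close> makes any
  two of them meet in a common (possibly empty) face.\<close>

definition triangulation_of_Omega :: "(real ^ 'd) set set \<Rightarrow> bool"
  where "triangulation_of_Omega \<T> \<longleftrightarrow>
    triangulation \<T> \<and> (\<forall>S\<in>\<T>. int CARD('d) simplex S) \<and> \<Union>\<T> = closure Omega"

text \<open>Uniform refinement: every simplex of \<open>\<T>\<close> is split through the midpoints of its edges into
  \<open>2 ^ d\<close> simplices of equal volume. The number of pieces need not be stated: both families
  triangulate the cube, so the simplices of \<open>\<T>'\<close> inside a given \<open>S\<close> fill \<open>S\<close>. The case \<open>x = y\<close>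
  gives the vertices of \<open>S\<close> themselves. For \<open>d \<ge> 3\<close> this does not fix how
  the interior of a simplex is cut, so it covers the usual red and edgewise subdivisions.\<close>

definition uniform_refinement :: "(real ^ 'd) set set \<Rightarrow> (real ^ 'd) set set \<Rightarrow> bool"
  where "uniform_refinement \<T> \<T>' \<longleftrightarrow>
    (\<forall>S'\<in>\<T>'. \<exists>S\<in>\<T>. S' \<subseteq> S \<and>
       (\<forall>v. v extreme_point_of S' \<longrightarrow>
          (\<exists>x y. x extreme_point_of S \<and> y extreme_point_of S \<and> v = midpoint x y)) \<and>
       measure lebesgue S' = measure lebesgue S / 2 ^ CARD('d))"

section \<open>The finite element space\<close>

text \<open>Functions on \<open>Omega\<close> are represented by total functions whose values outside \<open>Omega\<close> are
  irrelevant; equalities between them are therefore required on \<open>Omega\<close> only.\<close>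

definition P1_zero_mean :: "(real ^ 'd) set set \<Rightarrow> (real ^ 'd \<Rightarrow> real) set"
  where "P1_zero_mean \<T> =
    {u. continuous_on Omega u \<and>
        (\<forall>S\<in>\<T>. \<exists>g c. \<forall>x \<in> S \<inter> Omega. u x = g \<bullet> x + c) \<and>
        (LINT x:Omega|lebesgue. u x) = 0}"

definition is_basis_on_Omega :: "(real ^ 'd \<Rightarrow> real) set \<Rightarrow> ('m::finite \<Rightarrow> real ^ 'd \<Rightarrow> real) \<Rightarrow> bool"
  where "is_basis_on_Omega W \<phi> \<longleftrightarrow>
    (\<forall>p. \<phi> p \<in> W) \<and>
    (\<forall>c. (\<forall>x\<in>Omega. (\<Sum>p\<in>UNIV. c p * \<phi> p x) = 0) \<longrightarrow> (\<forall>p. c p = 0)) \<and>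
    (\<forall>u\<in>W. \<exists>c. \<forall>x\<in>Omega. u x = (\<Sum>p\<in>UNIV. c p * \<phi> p x))"

text \<open>Unspecified where \<open>u\<close> is not differentiable, which for a finite element function is a null
  set in \<open>Omega\<close>.\<close>

definition grad :: "('a::real_inner \<Rightarrow> real) \<Rightarrow> 'a \<Rightarrow> 'a"
  where "grad u x = (THE D. GDERIV u x :> D)"

section \<open>The discrete energy\<close>

definition stiffness ::
    "(real ^ 'd) set \<Rightarrow> ('m::finite \<Rightarrow> real ^ 'd \<Rightarrow> real) \<Rightarrow> real ^ 'm ^ 'm"
  where "stiffness S \<phi> = (\<chi> p q. LINT x:S|lebesgue. grad (\<phi> p) x \<bullet> grad (\<phi> q) x)"

definition system_matrix ::
    "real \<Rightarrow> ('n::finite \<Rightarrow> (real ^ 'd) set) \<Rightarrow> ('m::finite \<Rightarrow> real ^ 'd \<Rightarrow> real) \<Rightarrow>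
     real ^ 'n \<Rightarrow> real ^ 'm ^ 'm"
  where "system_matrix \<delta> T \<phi> \<mu> = (\<Sum>i\<in>UNIV. (\<mu> $ i + \<delta>) *\<^sub>R stiffness (T i) \<phi>)"

definition load_vector ::
    "(real ^ 'd \<Rightarrow> real) \<Rightarrow> ('m::finite \<Rightarrow> real ^ 'd \<Rightarrow> real) \<Rightarrow> real ^ 'm"
  where "load_vector f \<phi> = (\<chi> p. LINT x:Omega|lebesgue. f x * \<phi> p x)"

definition volumes :: "('n::finite \<Rightarrow> (real ^ 'd) set) \<Rightarrow> real ^ 'n"
  where "volumes T = (\<chi> i. measure lebesgue (T i))"

definition orthant :: "(real ^ 'n) set"
  where "orthant = {\<mu>. \<forall>i. 0 \<le> \<mu> $ i}"

definition energy ::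
    "real \<Rightarrow> (real ^ 'd \<Rightarrow> real) \<Rightarrow> ('n::finite \<Rightarrow> (real ^ 'd) set) \<Rightarrow>
     ('m::finite \<Rightarrow> real ^ 'd \<Rightarrow> real) \<Rightarrow> real ^ 'n \<Rightarrow> ereal"
  where "energy \<delta> f T \<phi> \<mu> =
    (if \<mu> \<in> orthant
     then ereal (load_vector f \<phi> \<bullet> (matrix_inv (system_matrix \<delta> T \<phi> \<mu>) *v load_vector f \<phi>)
                 + \<mu> \<bullet> volumes T)
     else \<infinity>)"

section \<open>Subdifferentials and gradient flows\<close>

definition subdifferential :: "('a::real_inner \<Rightarrow> ereal) \<Rightarrow> 'a \<Rightarrow> 'a set"
  where "subdifferential E x =
    {v. \<bar>E x\<bar> \<noteq> \<infinity> \<and> (\<forall>y. E x + ereal (v \<bullet> (y - x)) \<le> E y)}"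

definition min_subgradient :: "('a::real_inner \<Rightarrow> ereal) \<Rightarrow> 'a \<Rightarrow> 'a"
  where "min_subgradient E x = (THE v. is_arg_min norm (\<lambda>w. w \<in> subdifferential E x) v)"

text \<open>The finite families of non-overlapping intervals in the usual definition are the divisions
  (\<open>division_of\<close>) of subsets of the interval.\<close>

definition absolutely_continuous_curve_on :: "real \<Rightarrow> real \<Rightarrow> (real \<Rightarrow> 'a::real_normed_vector) \<Rightarrow> bool"
  where "absolutely_continuous_curve_on a b \<gamma> \<longleftrightarrow>
    (\<forall>\<epsilon>>0. \<exists>\<eta>>0. \<forall>D S. D division_of S \<and> S \<subseteq> {a..b} \<and> (\<Sum>I\<in>D. Sup I - Inf I) < \<eta> \<longrightarrow>
        (\<Sum>I\<in>D. norm (\<gamma> (Sup I) - \<gamma> (Inf I))) < \<epsilon>)"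

text \<open>Curves \<open>[0,\<infinity>) \<rightarrow> 'a\<close> are total functions whose values at negative times are irrelevant.\<close>

definition locally_absolutely_continuous :: "(real \<Rightarrow> 'a::real_normed_vector) \<Rightarrow> bool"
  where "locally_absolutely_continuous \<gamma> \<longleftrightarrow>
    (\<forall>a b. 0 \<le> a \<longrightarrow> a \<le> b \<longrightarrow> absolutely_continuous_curve_on a b \<gamma>)"

definition solves_gradient_flow :: "('a::euclidean_space \<Rightarrow> ereal) \<Rightarrow> (real \<Rightarrow> 'a) \<Rightarrow> bool"
  where "solves_gradient_flow E \<gamma> \<longleftrightarrow>
    (AE t in lebesgue. 0 < t \<longrightarrow> (\<gamma> has_vector_derivative - min_subgradient E (\<gamma> t)) (at t))"

definition energy_identity :: "('a::euclidean_space \<Rightarrow> ereal) \<Rightarrow> (real \<Rightarrow> 'a) \<Rightarrow> bool"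
  where "energy_identity E \<gamma> \<longleftrightarrow>
    (\<forall>t>0. set_integrable lebesgue {0..t} (\<lambda>s. (norm (min_subgradient E (\<gamma> s)))\<^sup>2) \<and>
           E (\<gamma> t) = E (\<gamma> 0) - ereal (LINT s:{0..t}|lebesgue. (norm (min_subgradient E (\<gamma> s)))\<^sup>2))"

text \<open>The energy identity alone does not determine the curve: adding to the velocity any component
  orthogonal to the minimal subgradient preserves it. Hence an energy solution of the gradient flow
  is required to satisfy the flow equation almost everywhere as well.\<close>

definition energy_solution ::
    "(real ^ 'n \<Rightarrow> ereal) \<Rightarrow> real ^ 'n \<Rightarrow> (real \<Rightarrow> real ^ 'n) \<Rightarrow> bool"
  where "energy_solution E \<mu>0 \<mu> \<longleftrightarrow>
    \<mu> 0 = \<mu>0 \<and> (\<forall>t\<ge>0. \<mu> t \<in> orthant) \<and>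
    locally_absolutely_continuous \<mu> \<and> (AE t in lebesgue. 0 < t \<longrightarrow> \<mu> differentiable at t) \<and>
    solves_gradient_flow E \<mu> \<and> energy_identity E \<mu>"

end

(*
  Since the stiffness matrices are positive semidefinite with positive definite sum, the energy is
  g on the orthant for a function g that is convex and smooth up to the boundary: with
  w = A(mu)^-1 f one has g(nu) - g(mu) - <G(mu), nu - mu> = <w', A(nu) w'>, w' = w(nu) - w(mu), where
  G(mu)_i = a_i - <w, A_i w>. Moreover G is bounded and Lipschitz on the orthant, and g attains its
  minimum there because the volumes a_i are positive.  The minimal subgradient is G with the
  positive entries on the active faces mu_i = 0 replaced by 0, so the gradient flow is the ODE
  mu' = -G(mu) reflected componentwise at 0.  The Skorokhod map turns it into an integral equation,
  which is solved by Banach's fixed point theorem; its solution is differentiable with the right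
  derivative outside a countable set.  Uniqueness and convergence follow from the monotonicity of
  the subdifferential: the distance between two solutions, and in particular to a minimizer, never
  increases, and t (g(mu(t)) - min g) <= |mu(0) - m|^2 / 2.
*)
theory Submission
  imports Defs
begin

text \<open>The obstacle is that the minimal subgradient jumps when an entry of the weight reaches
  0, so the flow is an ODE with a discontinuous right side. Reflection takes the jump out of the
  vector field: the drift \<open>- G\<close> stays Lipschitz, and the Skorokhod map is Lipschitz in
  the sup norm, so a Picard iteration applies. The shift by \<open>\<delta> n > 0\<close> makes the
  system matrix coercive uniformly up to the boundary of the orthant; the bounds on the state, on
  the gradient and on its Lipschitz constant all come from this. Differentiability outside a
  countable set is obtained for the constructed curve, whereas uniqueness and convergence concern
  arbitrary energy solutions, which satisfy the flow equation only outside a null set. Hence a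
  fundamental theorem of calculus with a negligible exceptional set is needed, and it holds for
  absolutely continuous curves.\<close>

section \<open>Absolutely continuous curves\<close>

text \<open>The exceptional set \<open>N\<close> lies in an open set \<open>U\<close> of small measure, which serves as gauge at the
  tags in \<open>N\<close>: their intervals have small total length, so absolute continuity makes the
  corresponding increments negligible.\<close>

lemma fundamental_theorem_of_calculus_absolutely_continuous:
  fixes f :: "real \<Rightarrow> 'a::banach"
  assumes "a \<le> b" and ac: "absolutely_continuous_curve_on a b f" and N: "negligible N"
    and der: "\<And>x. x \<in> {a..b} - N \<Longrightarrow> (f has_vector_derivative f' x) (at x within {a..b})"
  shows "(f' has_integral (f b - f a)) {a..b}"
proof (cases "a < b")
  case False
  then show ?thesis using \<open>a \<le> b\<close> by (auto simp: has_integral_refl)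
next
  case True
  \<comment> \<open>Zeroing the derivative on \<open>N\<close> removes the Riemann terms at the bad
    tags, so only the increments of \<open>f\<close> remain to be estimated there.\<close>
  define F where "F x = (if x \<in> N then 0 else f' x)" for x
  have "(F has_integral (f b - f a)) {a..b}"
    unfolding has_integral_factor_content_real
  proof safe
    fix e :: real
    assume e: "e > 0"
    have e2: "e/2 > 0" and e2ba: "e/2 * (b - a) > 0" using e True by auto
    obtain \<eta> where \<eta>: "\<eta> > 0"
      and ac': "\<And>D S. D division_of S \<Longrightarrow> S \<subseteq> {a..b} \<Longrightarrow> (\<Sum>I\<in>D. Sup I - Inf I) < \<eta> \<Longrightarrow>
        (\<Sum>I\<in>D. norm (f (Sup I) - f (Inf I))) < e/2 * (b - a)"
      using ac e2ba unfolding absolutely_continuous_curve_on_def by metis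
    obtain U where U: "open U" "N \<subseteq> U" "U - N \<in> lmeasurable" "emeasure lebesgue (U - N) < ennreal \<eta>"
      using sets_lebesgue_outer_open[OF negligible_imp_sets[OF N] \<eta>] by metis
    have Nnull: "N \<in> null_sets lebesgue"
      using N by (simp add: negligible_iff_null_sets)
    have Ul: "U \<in> lmeasurable"
    proof -
      have "U = (U - N) \<union> N" using U(2) by auto
      then show ?thesis
        by (metis U(3) N negligible_imp_measurable fmeasurable.Un)
    qed
    have "emeasure lebesgue U = emeasure lebesgue (U - N)"
      using Nnull Ul by (metis emeasure_Diff_null_set fmeasurableD)
    then have Um: "measure lebesgue U < \<eta>"
      using U(4) Ul \<eta> by (metis emeasure_eq_measure2 ennreal_less_iff measure_nonneg)
    have "\<exists>d>0. x \<in> {a..b} - N \<longrightarrow>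
         (\<forall>y\<in>{a..b}. norm (y-x) < d \<longrightarrow> norm (f y - f x - (y-x) *\<^sub>R F x) \<le> e/2 * norm (y-x))" for x
    proof (cases "x \<in> {a..b} - N")
      case xin: True
      then have "F x = f' x" by (simp add: F_def)
      with der[OF xin] e2 show ?thesis
        unfolding has_vector_derivative_def has_derivative_within_alt by metis
    qed (auto intro: exI[of _ 1])
    then obtain d where d: "\<And>x. 0 < d x"
      "\<And>x y. \<lbrakk>x \<in> {a..b} - N; y \<in> {a..b}; norm (y-x) < d x\<rbrakk>
          \<Longrightarrow> norm (f y - f x - (y-x) *\<^sub>R F x) \<le> e/2 * norm (y-x)"
      by metis
    define \<gamma> where "\<gamma> x = (if x \<in> N then U else ball x (d x))" for x
    show "\<exists>\<gamma>. gauge \<gamma> \<and> (\<forall>p. p tagged_division_of {a..b} \<and> \<gamma> fine p \<longrightarrow>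
      norm ((\<Sum>(x, k)\<in>p. measure lborel k *\<^sub>R F x) - (f b - f a)) \<le> e * measure lborel {a..b})"
    proof (intro exI conjI allI impI)
      show "gauge \<gamma>"
        unfolding gauge_def \<gamma>_def using U d(1) by auto
    next
      fix p
      assume "p tagged_division_of {a..b} \<and> \<gamma> fine p"
      then have ptag: "p tagged_division_of {a..b}" and fine: "\<gamma> fine p" by auto
      have finp: "finite p" using ptag by blast
      have interval: "\<exists>u v. K = {u..v} \<and> u \<le> x \<and> x \<le> v \<and> a \<le> u \<and> v \<le> b" if xK: "(x,K) \<in> p" for x K
      proof -
        obtain u v where "K = cbox u v" "x \<in> K" "K \<subseteq> {a..b}"
          using tagged_division_ofD(2,3,4)[OF ptag xK] by blast
        then show ?thesis by (auto simp: subset_iff)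
      qed
      let ?t = "\<lambda>(x, K). measure lborel K *\<^sub>R F x - (f (Sup K) - f (Inf K))"
      define q where "q = {xK \<in> p. fst xK \<in> N}"
      have ba: "b - a = (\<Sum>(x,K)\<in>p. Sup K - Inf K)" and
        fba: "f b - f a = (\<Sum>(x,K)\<in>p. f(Sup K) - f(Inf K))"
        using additive_tagged_division_1[where f= "\<lambda>x. x"] additive_tagged_division_1[where f= f]
            \<open>a \<le> b\<close> ptag by auto
      have good: "norm (?t xK) \<le> e/2 * (case xK of (x,K) \<Rightarrow> Sup K - Inf K)" if "xK \<in> p - q" for xK
      proof -
        obtain x K where xK: "xK = (x,K)" by fastforce
        with that have inp: "(x,K) \<in> p" and xN: "x \<notin> N" by (auto simp: q_def)
        obtain u v where K: "K = {u..v}" and uv: "u \<le> x" "x \<le> v" "a \<le> u" "v \<le> b"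
          using interval[OF inp] by auto
        have "u \<in> K" "v \<in> K" using uv by (auto simp: K)
        moreover have "K \<subseteq> ball x (d x)" using fineD[OF fine inp] xN by (simp add: \<gamma>_def)
        ultimately have "u \<in> ball x (d x)" "v \<in> ball x (d x)"
          by blast+
        then have "norm (u - x) < d x" "norm (v - x) < d x"
          by (simp_all add: dist_norm norm_minus_commute)
        then have "norm (f u - f x - (u-x) *\<^sub>R F x) \<le> e/2 * norm (u-x)"
          "norm (f v - f x - (v-x) *\<^sub>R F x) \<le> e/2 * norm (v-x)"
          using d(2)[of x u] d(2)[of x v] uv xN by auto
        moreover have "norm ((v - u) *\<^sub>R F x - (f v - f u)) =
            norm (f u - f x - (u - x) *\<^sub>R F x - (f v - f x - (v - x) *\<^sub>R F x))"
          by (auto simp: algebra_simps)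
        moreover have "\<dots> \<le> norm (f u - f x - (u - x) *\<^sub>R F x) + norm (f v - f x - (v - x) *\<^sub>R F x)"
          by (rule norm_triangle_ineq4)
        ultimately have "norm ((v - u) *\<^sub>R F x - (f v - f u)) \<le> e/2 * norm (u-x) + e/2 * norm (v-x)"
          by linarith
        also have "\<dots> = e/2 * (v - u)" using uv by (simp add: field_simps)
        finally show ?thesis using uv by (simp add: xK K)
      qed
      have qp: "q \<subseteq> p" by (auto simp: q_def)
      have "q tagged_partial_division_of {a..b}"
        by (rule tagged_partial_division_subset[OF _ qp]) (use ptag in \<open>simp add: tagged_division_of_def\<close>)
      then have qtag: "q tagged_division_of (\<Union>(snd ` q))"
        by (rule tagged_partial_division_of_Union_self)
      have qdiv: "snd ` q division_of (\<Union>(snd ` q))"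
        by (rule division_of_tagged_division[OF qtag])
      have qsub: "\<Union>(snd ` q) \<subseteq> {a..b}"
        using interval by (fastforce simp: q_def)
      have "(\<Sum>I\<in>snd ` q. Sup I - Inf I) = (\<Sum>I\<in>snd ` q. measure lebesgue I)"
        using interval by (intro sum.cong) (fastforce simp: q_def)+
      also have "\<dots> = measure lebesgue (\<Union>(snd ` q))"
        by (rule content_division[OF qdiv])
      also have "\<dots> \<le> measure lebesgue U"
      proof (rule measure_mono_fmeasurable[OF _ _ Ul])
        show "\<Union>(snd ` q) \<subseteq> U"
          using fineD[OF fine] by (fastforce simp: q_def \<gamma>_def)
        show "\<Union>(snd ` q) \<in> sets lebesgue"
          using lmeasurable_division[OF qdiv] by auto
      qed
      finally have "(\<Sum>I\<in>snd ` q. Sup I - Inf I) < \<eta>" using Um by linarith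
      then have small: "(\<Sum>I\<in>snd ` q. norm (f (Sup I) - f (Inf I))) < e/2 * (b - a)"
        by (rule ac'[OF qdiv qsub])
      \<comment> \<open>The summand must vanish on intervals with empty interior, since only those
        can belong to several tags. One-point intervals have increment 0 anyway; the empty one is
        set to 0 because \<open>Sup {}\<close> is unspecified.\<close>
      let ?d = "\<lambda>K. if K = {} then 0 else norm (f (Sup K) - f (Inf K))"
      have "(\<Sum>(x,K)\<in>q. norm (f (Sup K) - f (Inf K))) = (\<Sum>(x,K)\<in>q. ?d K)"
        using interval by (intro sum.cong) (fastforce simp: q_def)+
      also have "\<dots> = (\<Sum>I\<in>snd ` q. ?d I)"
        by (rule sum.over_tagged_division_lemma[OF qtag]) auto
      also have "\<dots> = (\<Sum>I\<in>snd ` q. norm (f (Sup I) - f (Inf I)))"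
        using interval by (intro sum.cong) (fastforce simp: q_def)+
      finally have "(\<Sum>(x,K)\<in>q. norm (f (Sup K) - f (Inf K))) = (\<Sum>I\<in>snd ` q. norm (f (Sup I) - f (Inf I)))" .
      with small have bad: "(\<Sum>(x,K)\<in>q. norm (f (Sup K) - f (Inf K))) < e/2 * (b - a)"
        by simp
      have "(\<Sum>(x, k)\<in>p. measure lborel k *\<^sub>R F x) - (f b - f a) = (\<Sum>xK\<in>p. ?t xK)"
        by (simp add: fba sum_subtractf[symmetric] split_def)
      also have "\<dots> = (\<Sum>xK\<in>p - q. ?t xK) + (\<Sum>xK\<in>q. ?t xK)"
        by (rule sum.subset_diff[OF qp finp])
      also have "norm \<dots> \<le> norm (\<Sum>xK\<in>p - q. ?t xK) + norm (\<Sum>xK\<in>q. ?t xK)"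
        by (rule norm_triangle_ineq)
      also have "norm (\<Sum>xK\<in>p - q. ?t xK) \<le> (\<Sum>xK\<in>p - q. e/2 * (case xK of (x,K) \<Rightarrow> Sup K - Inf K))"
        using good by (rule sum_norm_le)
      also have "\<dots> \<le> (\<Sum>xK\<in>p. e/2 * (case xK of (x,K) \<Rightarrow> Sup K - Inf K))"
        using finp interval e by (intro sum_mono2) fastforce+
      also have "\<dots> = e/2 * (b - a)" by (simp add: ba sum_distrib_left)
      also have "norm (\<Sum>xK\<in>q. ?t xK) \<le> (\<Sum>(x,K)\<in>q. norm (f (Sup K) - f (Inf K)))"
        by (rule sum_norm_le) (auto simp: q_def F_def norm_minus_commute)
      also have "e/2 * (b - a) + \<dots> \<le> e * (b - a)" using bad by (simp add: field_simps)
      finally show "norm ((\<Sum>(x, k)\<in>p. measure lborel k *\<^sub>R F x) - (f b - f a)) \<le> e * measure lborel {a..b}"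
        using True by simp
    qed
  qed
  then show ?thesis
    by (rule has_integral_spike[OF N, rotated]) (auto simp: F_def)
qed

text \<open>The Cantor function has derivative 0 off a null set and still increases; absolute
  continuity is what makes an almost everywhere sign condition conclusive. The contraction and the
  rate of energy decay rest on this.\<close>

lemma absolutely_continuous_antimono:
  fixes f :: "real \<Rightarrow> real"
  assumes "a \<le> b" "absolutely_continuous_curve_on a b f" "negligible N"
    and "\<And>x. a < x \<Longrightarrow> x < b \<Longrightarrow> x \<notin> N \<Longrightarrow> \<exists>D\<le>0. (f has_real_derivative D) (at x)"
  shows "f b \<le> f a"
proof -
  define N' where "N' = N \<union> {a,b}"
  have "\<exists>D. D \<le> 0 \<and> (f has_real_derivative D) (at x)" if "x \<in> {a..b} - N'" for x
    using assms(4)[of x] that unfolding N'_def by force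
  then obtain f' where f': "\<And>x. x \<in> {a..b} - N' \<Longrightarrow> f' x \<le> 0 \<and> (f has_real_derivative f' x) (at x)"
    by metis
  have N': "negligible N'" using assms(3) by (simp add: N'_def)
  define F where "F x = (if x \<in> {a..b} - N' then f' x else 0)" for x
  have "(F has_integral (f b - f a)) {a..b}"
  proof (rule fundamental_theorem_of_calculus_absolutely_continuous[OF assms(1,2) N'])
    show "(f has_vector_derivative F x) (at x within {a..b})" if "x \<in> {a..b} - N'" for x
      using f'[OF that] that
      by (simp add: F_def has_real_derivative_iff_has_vector_derivative has_vector_derivative_at_within)
  qed
  moreover have "((\<lambda>x. 0) has_integral (0::real)) {a..b}" by simp
  ultimately have "f b - f a \<le> 0"
    by (rule has_integral_le) (use f' in \<open>auto simp: F_def\<close>)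
  then show ?thesis by simp
qed

text \<open>Divisions see a curve only through its increments over intervals. With the identity as
  \<open>g\<close> this covers Lipschitz curves; with a given curve as \<open>g\<close>, Lipschitz
  functions of that curve.\<close>

lemma absolutely_continuous_curve_dominated:
  fixes f :: "real \<Rightarrow> 'a::real_normed_vector" and g :: "real \<Rightarrow> 'b::real_normed_vector"
  assumes g: "absolutely_continuous_curve_on a b g" 
    and le: "\<And>s t. a \<le> s \<Longrightarrow> s \<le> t \<Longrightarrow> t \<le> b \<Longrightarrow> norm (f t - f s) \<le> C * norm (g t - g s)"
  shows "absolutely_continuous_curve_on a b f"
  unfolding absolutely_continuous_curve_on_def
proof (intro allI impI)
  fix \<epsilon> :: real assume \<epsilon>: "\<epsilon> > 0"
  \<comment> \<open>\<open>C\<close> may be zero or negative; dividing by it requires a positive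
    constant.\<close>
  define K where "K = max C 1"
  have K: "K > 0" "C \<le> K" by (auto simp: K_def)
  then have "\<epsilon> / K > 0" using \<epsilon> by simp
  then obtain \<eta> where \<eta>: "\<eta> > 0" "\<And>D S. D division_of S \<Longrightarrow> S \<subseteq> {a..b} \<Longrightarrow> (\<Sum>I\<in>D. Sup I - Inf I) < \<eta> \<Longrightarrow>
        (\<Sum>I\<in>D. norm (g (Sup I) - g (Inf I))) < \<epsilon> / K"
    using g unfolding absolutely_continuous_curve_on_def by metis
  show "\<exists>\<eta>>0. \<forall>D S. D division_of S \<and> S \<subseteq> {a..b} \<and> (\<Sum>I\<in>D. Sup I - Inf I) < \<eta> \<longrightarrow>
        (\<Sum>I\<in>D. norm (f (Sup I) - f (Inf I))) < \<epsilon>"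
  proof (intro exI conjI allI impI)
    fix D S assume DS: "D division_of S \<and> S \<subseteq> {a..b} \<and> (\<Sum>I\<in>D. Sup I - Inf I) < \<eta>"
    have "norm (f (Sup I) - f (Inf I)) \<le> K * norm (g (Sup I) - g (Inf I))" if I: "I \<in> D" for I
    proof -
      have D: "D division_of S" using DS by simp
      obtain u v where "I = {u..v}"
        using division_ofD(4)[OF D I] by auto
      moreover have "I \<noteq> {}" "I \<subseteq> {a..b}"
        using division_ofD(2,3)[OF D I] DS by auto
      ultimately have "I = {u..v}" "u \<le> v" "a \<le> u" "v \<le> b"
        by auto
      then have "norm (f (Sup I) - f (Inf I)) \<le> C * norm (g (Sup I) - g (Inf I))"
        using le[of u v] by simp
      also have "\<dots> \<le> K * norm (g (Sup I) - g (Inf I))" using K by (simp add: mult_right_mono)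
      finally show ?thesis .
    qed
    then have "(\<Sum>I\<in>D. norm (f (Sup I) - f (Inf I))) \<le> (\<Sum>I\<in>D. K * norm (g (Sup I) - g (Inf I)))"
      by (rule sum_mono)
    also have "\<dots> = K * (\<Sum>I\<in>D. norm (g (Sup I) - g (Inf I)))" by (simp add: sum_distrib_left)
    also have "\<dots> < K * (\<epsilon> / K)" using DS \<eta>(2) K by (intro mult_strict_left_mono) auto
    finally show "(\<Sum>I\<in>D. norm (f (Sup I) - f (Inf I))) < \<epsilon>" using K by simp
  qed (rule \<eta>)
qed

lemma absolutely_continuous_curve_id: "absolutely_continuous_curve_on a b (\<lambda>t::real. t)"
  unfolding absolutely_continuous_curve_on_def
proof (intro allI impI)
  fix \<epsilon> :: real assume \<epsilon>: "\<epsilon> > 0"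
  have "norm (Sup I - Inf I) = Sup I - Inf I" if "D division_of S" "I \<in> D" for D S and I :: "real set"
    using division_ofD(3,4)[OF that] by (auto simp: box_real)
  then show "\<exists>\<eta>>0. \<forall>D S. D division_of S \<and> S \<subseteq> {a..b} \<and> (\<Sum>I\<in>D. Sup I - Inf I) < \<eta> \<longrightarrow>
        (\<Sum>I\<in>D. norm (Sup I - Inf I)) < \<epsilon>"
    using \<epsilon> by (intro exI[of _ \<epsilon>]) (auto cong: sum.cong)
qed

text \<open>Sums and differences are bounded linear images of a pair, so one lemma on linear images
  serves both.\<close>

lemma absolutely_continuous_curve_Pair:
  assumes f: "absolutely_continuous_curve_on a b f" and g: "absolutely_continuous_curve_on a b g"
  shows "absolutely_continuous_curve_on a b (\<lambda>t. (f t, g t))"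
  unfolding absolutely_continuous_curve_on_def
proof (intro allI impI)
  fix \<epsilon> :: real assume "\<epsilon> > 0"
  then have \<epsilon>: "\<epsilon> / 2 > 0" by simp
  obtain \<eta> where \<eta>: "\<eta> > 0" "\<And>D S. D division_of S \<Longrightarrow> S \<subseteq> {a..b} \<Longrightarrow> (\<Sum>I\<in>D. Sup I - Inf I) < \<eta> \<Longrightarrow>
        (\<Sum>I\<in>D. norm (f (Sup I) - f (Inf I))) < \<epsilon> / 2"
    using f \<epsilon> unfolding absolutely_continuous_curve_on_def by metis
  obtain \<zeta> where \<zeta>: "\<zeta> > 0" "\<And>D S. D division_of S \<Longrightarrow> S \<subseteq> {a..b} \<Longrightarrow> (\<Sum>I\<in>D. Sup I - Inf I) < \<zeta> \<Longrightarrow>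
        (\<Sum>I\<in>D. norm (g (Sup I) - g (Inf I))) < \<epsilon> / 2"
    using g \<epsilon> unfolding absolutely_continuous_curve_on_def by metis
  show "\<exists>\<eta>>0. \<forall>D S. D division_of S \<and> S \<subseteq> {a..b} \<and> (\<Sum>I\<in>D. Sup I - Inf I) < \<eta> \<longrightarrow>
        (\<Sum>I\<in>D. norm ((f (Sup I), g (Sup I)) - (f (Inf I), g (Inf I)))) < \<epsilon>"
  proof (intro exI conjI allI impI)
    fix D S assume DS: "D division_of S \<and> S \<subseteq> {a..b} \<and> (\<Sum>I\<in>D. Sup I - Inf I) < min \<eta> \<zeta>"
    have "(\<Sum>I\<in>D. norm ((f (Sup I), g (Sup I)) - (f (Inf I), g (Inf I))))
        \<le> (\<Sum>I\<in>D. norm (f (Sup I) - f (Inf I)) + norm (g (Sup I) - g (Inf I)))"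
      by (rule sum_mono) (simp add: norm_Pair_le)
    then show "(\<Sum>I\<in>D. norm ((f (Sup I), g (Sup I)) - (f (Inf I), g (Inf I)))) < \<epsilon>"
      using \<eta>(2)[of D S] \<zeta>(2)[of D S] DS by (simp add: sum.distrib)
  qed (use \<eta> \<zeta> in auto)
qed

lemma absolutely_continuous_curve_continuous:
  assumes f: "absolutely_continuous_curve_on a b f"
  shows "continuous_on {a..b} f"
  unfolding continuous_on_iff
proof (intro ballI allI impI)
  fix x and e :: real assume x: "x \<in> {a..b}" and e: "e > 0"
  obtain \<eta> where \<eta>: "\<eta> > 0" "\<And>D S. D division_of S \<Longrightarrow> S \<subseteq> {a..b} \<Longrightarrow> (\<Sum>I\<in>D. Sup I - Inf I) < \<eta> \<Longrightarrow>
        (\<Sum>I\<in>D. norm (f (Sup I) - f (Inf I))) < e"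
    using f e unfolding absolutely_continuous_curve_on_def by metis
  have "norm (f v - f u) < e" if "u \<le> v" "a \<le> u" "v \<le> b" "v - u < \<eta>" for u v
  proof -
    have "{{u..v}} division_of {u..v}"
      using division_of_self[of u v] that by (simp add: box_real)
    from \<eta>(2)[OF this] that show ?thesis by simp
  qed
  note near = this
  have "dist (f y) (f x) < e" if "y \<in> {a..b}" "dist y x < \<eta>" for y
    using that x near[of x y] near[of y x]
    by (cases "x \<le> y") (auto simp: dist_norm norm_minus_commute)
  with \<eta>(1) show "\<exists>d>0. \<forall>y\<in>{a..b}. dist y x < d \<longrightarrow> dist (f y) (f x) < e" by blast
qed

lemma absolutely_continuous_curve_const: "absolutely_continuous_curve_on a b (\<lambda>t. c)"
  by (rule absolutely_continuous_curve_dominated[OF absolutely_continuous_curve_id, where C=0]) simp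

lemma absolutely_continuous_curve_linear:
  assumes f: "absolutely_continuous_curve_on a b f" and F: "bounded_linear F"
  shows "absolutely_continuous_curve_on a b (\<lambda>t. F (f t))"
proof -
  obtain C where "\<And>x. norm (F x) \<le> norm x * C"
    using bounded_linear.bounded[OF F] by blast
  then show ?thesis
    by (intro absolutely_continuous_curve_dominated[OF f, where C=C])
      (simp add: linear_diff[OF bounded_linear.linear[OF F], symmetric] mult.commute)
qed

lemma absolutely_continuous_curve_add:
  assumes "absolutely_continuous_curve_on a b f" "absolutely_continuous_curve_on a b g"
  shows "absolutely_continuous_curve_on a b (\<lambda>t. f t + g t)"
  using absolutely_continuous_curve_linear[OF absolutely_continuous_curve_Pair[OF assms]
      bounded_linear_add[OF bounded_linear_fst bounded_linear_snd]] by simp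

lemma absolutely_continuous_curve_diff:
  assumes "absolutely_continuous_curve_on a b f" "absolutely_continuous_curve_on a b g"
  shows "absolutely_continuous_curve_on a b (\<lambda>t. f t - g t)"
  using absolutely_continuous_curve_linear[OF absolutely_continuous_curve_Pair[OF assms]
      bounded_linear_sub[OF bounded_linear_fst bounded_linear_snd]] by simp

text \<open>Squaring is Lipschitz only on bounded sets; continuity on the compact interval supplies
  the bound \<open>M\<close> and with it the constant \<open>2 * M\<close>.\<close>

lemma absolutely_continuous_curve_norm_squared:
  fixes f :: "real \<Rightarrow> 'a::real_normed_vector"
  assumes f: "absolutely_continuous_curve_on a b f"
  shows "absolutely_continuous_curve_on a b (\<lambda>t. (norm (f t))\<^sup>2)"
proof -
  have "compact (f ` {a..b})"
    by (intro compact_continuous_image absolutely_continuous_curve_continuous[OF f]) auto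
  then obtain M where M: "\<And>t. t \<in> {a..b} \<Longrightarrow> norm (f t) \<le> M"
    using compact_imp_bounded bounded_iff by (metis image_eqI)
  show ?thesis
  proof (rule absolutely_continuous_curve_dominated[OF f])
    fix s t assume st: "a \<le> s" "s \<le> t" "t \<le> b"
    have "\<bar>(norm (f t))\<^sup>2 - (norm (f s))\<^sup>2\<bar> = (norm (f t) + norm (f s)) * \<bar>norm (f t) - norm (f s)\<bar>"
      by (simp add: power2_eq_square square_diff_square_factored abs_mult)
    also have "\<dots> \<le> (2 * M) * norm (f t - f s)"
      using M[of s] M[of t] st norm_ge_zero[of "f t"]
      by (intro mult_mono norm_triangle_ineq3) (auto simp del: norm_ge_zero)
    finally show "norm ((norm (f t))\<^sup>2 - (norm (f s))\<^sup>2) \<le> (2 * M) * norm (f t - f s)" by simp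
  qed
qed

section \<open>Reflection at zero\<close>

text \<open>The Skorokhod map: \<open>reflect y\<close> is \<open>y\<close> pushed upwards by the smallest nondecreasing amount that
  keeps it nonnegative.\<close>

definition push :: "(real \<Rightarrow> real) \<Rightarrow> real \<Rightarrow> real"
  where "push y t = (SUP s\<in>{0..t}. max 0 (- y s))"

definition reflect :: "(real \<Rightarrow> real) \<Rightarrow> real \<Rightarrow> real"
  where "reflect y t = y t + push y t"

context
  fixes y :: "real \<Rightarrow> real" and B :: real
  assumes lip: "\<And>s t. 0 \<le> s \<Longrightarrow> s \<le> t \<Longrightarrow> \<bar>y t - y s\<bar> \<le> B * (t - s)"
begin

lemma lip_B_nonneg: "0 \<le> B"
  using lip[of 0 1] by simp

lemma push_bdd: "bdd_above ((\<lambda>s. max 0 (- y s)) ` {0..t})"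
proof (rule bdd_aboveI2)
  fix s assume s: "s \<in> {0..t}"
  then have "\<bar>y s - y 0\<bar> \<le> B * t"
    using lip[of 0 s] mult_left_mono[of s t B] lip_B_nonneg by simp
  then show "max 0 (- y s) \<le> \<bar>y 0\<bar> + B * t" by linarith
qed

lemma push_upper: "0 \<le> s \<Longrightarrow> s \<le> t \<Longrightarrow> max 0 (- y s) \<le> push y t"
  unfolding push_def by (rule cSUP_upper[OF _ push_bdd]) auto

lemma push_least: "0 \<le> t \<Longrightarrow> (\<And>s. 0 \<le> s \<Longrightarrow> s \<le> t \<Longrightarrow> max 0 (- y s) \<le> c) \<Longrightarrow> push y t \<le> c"
  unfolding push_def by (rule cSUP_least) auto

lemma push_nonneg: "0 \<le> t \<Longrightarrow> 0 \<le> push y t"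
  using push_upper[of t t] by simp

lemma push_mono: "0 \<le> s \<Longrightarrow> s \<le> t \<Longrightarrow> push y s \<le> push y t"
  by (rule push_least) (auto intro!: push_upper simp del: max.bounded_iff)

text \<open>The running maximum can grow only through values of \<open>- y\<close> between
  \<open>s\<close> and \<open>t\<close>, and these exceed the value at \<open>s\<close> by at most
  \<open>B * (t - s)\<close>.\<close>

lemma push_lipschitz:
  assumes "0 \<le> s" "s \<le> t"
  shows "push y t \<le> push y s + B * (t - s)"
proof (rule push_least)
  fix u assume u: "0 \<le> u" "u \<le> t"
  show "max 0 (- y u) \<le> push y s + B * (t - s)"
  proof (cases "u \<le> s")
    case True
    then show ?thesis using push_upper[of u s] u assms lip_B_nonneg
      by (intro add_increasing2) auto
  next
    case False
    then have "\<bar>y u - y s\<bar> \<le> B * (t - s)"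
      using lip[of s u] u assms mult_left_mono[of "u - s" "t - s" B] lip_B_nonneg by simp
    then show ?thesis using push_upper[of s s] assms by auto
  qed
qed (use assms in auto)

lemma reflect_nonneg: "0 \<le> t \<Longrightarrow> 0 \<le> reflect y t"
  using push_upper[of t t] by (simp add: reflect_def)

lemma reflect_increment: "0 \<le> s \<Longrightarrow> s \<le> t \<Longrightarrow> y t - y s \<le> reflect y t - reflect y s"
  using push_mono by (simp add: reflect_def)

lemma reflect_lipschitz: "0 \<le> s \<Longrightarrow> s \<le> t \<Longrightarrow> \<bar>reflect y t - reflect y s\<bar> \<le> 2 * B * (t - s)"
  using push_mono[of s t] push_lipschitz[of s t] lip[of s t] by (simp add: reflect_def)

lemma continuous_on_reflect: "continuous_on {0..} (reflect y)"
proof -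
  have *: "dist (reflect y t) (reflect y s) \<le> 2 * B * dist t s" if "0 \<le> s" "s \<le> t" for s t
    using reflect_lipschitz[OF that] that by (simp add: dist_real_def)
  have "(2 * B)-lipschitz_on {0..} (reflect y)"
  proof (rule lipschitz_onI)
    fix s t :: real assume "s \<in> {0..}" "t \<in> {0..}"
    then show "dist (reflect y s) (reflect y t) \<le> 2 * B * dist s t"
      using *[of s t] *[of t s] by (cases "s \<le> t") (auto simp: dist_commute)
  qed (use lip_B_nonneg in simp)
  then show ?thesis by (rule lipschitz_on_continuous_on)
qed

lemma continuous_on_lip: "continuous_on {0..} y"
proof -
  have "B-lipschitz_on {0..} y"
  proof (rule lipschitz_onI)
    fix s t :: real assume "s \<in> {0..}" "t \<in> {0..}"
    then show "dist (y s) (y t) \<le> B * dist s t"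
      using lip[of s t] lip[of t s] by (cases "s \<le> t") (auto simp: dist_real_def)
  qed (rule lip_B_nonneg)
  then show ?thesis by (rule lipschitz_on_continuous_on)
qed

text \<open>Complementarity: the push grows only while the reflected path is at 0. Had it grown
  after \<open>s\<close>, the maximum of \<open>max 0 (- y r)\<close> would be attained at some
  \<open>u > s\<close>, and there \<open>reflect y u \<le> 0\<close>. Positivity is not asked at
  \<open>s\<close> itself, so a free excursion may start at a zero.\<close>

lemma reflect_free:
  assumes "0 \<le> s" "s \<le> t" and pos: "\<And>u. s < u \<Longrightarrow> u \<le> t \<Longrightarrow> 0 < reflect y u"
  shows "reflect y t - reflect y s = y t - y s"
proof -
  have "\<exists>u\<in>{0..t}. \<forall>r\<in>{0..t}. max 0 (- y r) \<le> max 0 (- y u)"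
    using assms(1,2) by (intro continuous_attains_sup continuous_intros
        continuous_on_subset[OF continuous_on_lip]) auto
  then obtain u where u: "0 \<le> u" "u \<le> t" "\<And>r. 0 \<le> r \<Longrightarrow> r \<le> t \<Longrightarrow> max 0 (- y r) \<le> max 0 (- y u)"
    by auto
  have push_t: "push y t \<le> max 0 (- y u)" using u assms by (intro push_least) auto
  have "push y t \<le> push y s"
  proof (rule ccontr)
    assume less: "\<not> push y t \<le> push y s"
    then have "s < u" using push_upper[of u s] push_t u(1) by (cases "u \<le> s") auto
    moreover have "push y t \<le> - y u"
      using push_t less push_nonneg[OF assms(1)] by (auto simp: max_def split: if_splits)
    then have "reflect y u \<le> 0"
      using push_mono[of u t] u by (simp add: reflect_def)
    ultimately show False using pos[of u] u(2) by simp
  qed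
  then show ?thesis using push_mono[OF assms(1,2)] by (simp add: reflect_def)
qed

text \<open>The zeros between \<open>s\<close> and \<open>t\<close> form a nonempty compact set, and
  after the last one the path is free. Near a zero this expresses the reflected path as an increment
  of \<open>y\<close>, however complicated the zero set is, so that drift estimates carry
  over.\<close>

lemma reflect_last_zero:
  assumes "0 \<le> s" "s \<le> t" and "reflect y s = 0"
  obtains u where "s \<le> u" "u \<le> t" "reflect y t = y t - y u"
proof -
  define Z where "Z = {u \<in> {s..t}. reflect y u = 0}"
  have "closed Z"
    unfolding Z_def using assms(1)
    by (intro continuous_closed_preimage_constant continuous_on_subset[OF continuous_on_reflect]) auto
  moreover have "bounded Z"
    by (rule bounded_subset[OF bounded_closed_interval[of s t]]) (auto simp: Z_def)
  ultimately have "compact Z" by (simp add: compact_eq_bounded_closed)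
  moreover have "s \<in> Z" using assms by (simp add: Z_def)
  ultimately obtain u where u: "u \<in> Z" "\<And>r. r \<in> Z \<Longrightarrow> r \<le> u"
    using compact_attains_sup[of Z] by blast
  have "reflect y t - reflect y u = y t - y u"
  proof (rule reflect_free)
    show "0 \<le> u" "u \<le> t" using u(1) assms(1) by (auto simp: Z_def)
    fix r assume r: "u < r" "r \<le> t"
    then have "reflect y r \<noteq> 0" "0 \<le> r"
      using u(1) u(2)[of r] assms(1) by (auto simp: Z_def)
    then show "0 < reflect y r" using reflect_nonneg[of r] by simp
  qed
  then show thesis using u(1) by (intro that[of u]) (auto simp: Z_def)
qed

end

lemma push_stable:
  assumes y: "\<And>s t. 0 \<le> s \<Longrightarrow> s \<le> t \<Longrightarrow> \<bar>y t - y s\<bar> \<le> B * (t - s)"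
    and z: "\<And>s t. 0 \<le> s \<Longrightarrow> s \<le> t \<Longrightarrow> \<bar>z t - z s\<bar> \<le> C * (t - s)"
    and "0 \<le> t" and e: "\<And>s. 0 \<le> s \<Longrightarrow> s \<le> t \<Longrightarrow> \<bar>y s - z s\<bar> \<le> e"
  shows "push y t \<le> push z t + e"
proof (rule push_least[OF y \<open>0 \<le> t\<close>])
  fix s assume "0 \<le> s" "s \<le> t"
  then show "max 0 (- y s) \<le> push z t + e"
    using e[of s] push_upper[OF z, of s t] by auto
qed auto

text \<open>One \<open>e\<close> comes from the paths, the other from their pushes, since a supremum
  moves by no more than its entries. This is the estimate behind the contraction in the fixed point
  argument.\<close>

lemma reflect_stable:
  assumes y: "\<And>s t. 0 \<le> s \<Longrightarrow> s \<le> t \<Longrightarrow> \<bar>y t - y s\<bar> \<le> B * (t - s)"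
    and z: "\<And>s t. 0 \<le> s \<Longrightarrow> s \<le> t \<Longrightarrow> \<bar>z t - z s\<bar> \<le> C * (t - s)"
    and t: "0 \<le> t" and e: "\<And>s. 0 \<le> s \<Longrightarrow> s \<le> t \<Longrightarrow> \<bar>y s - z s\<bar> \<le> e"
  shows "\<bar>reflect y t - reflect z t\<bar> \<le> 2 * e"
  using push_stable[OF y z t e] push_stable[OF z y t, of e] e[OF t order_refl] e
  by (fastforce simp: reflect_def abs_minus_commute)

text \<open>The gaps to the right of such points are pairwise disjoint, and each contains a rational
  number.\<close>

lemma countable_right_isolated:
  fixes A :: "real set"
  shows "countable {t \<in> A. \<exists>e>0. \<forall>s. t < s \<longrightarrow> s < t + e \<longrightarrow> s \<notin> A}"
    (is "countable ?I")
proof -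
  have "\<exists>q::rat. t < of_rat q \<and> (\<forall>s\<in>A. t < s \<longrightarrow> of_rat q < s)" if tI: "t \<in> ?I" for t
  proof -
    obtain e where e: "e > 0" "\<And>s. t < s \<Longrightarrow> s < t + e \<Longrightarrow> s \<notin> A" using tI by blast
    obtain q where q: "t < of_rat q" "of_rat q < t + e" using of_rat_dense[of t "t + e"] e(1) by auto
    then show ?thesis using e(2) by (intro exI[of _ q]) force
  qed
  then have "\<forall>t\<in>?I. \<exists>q::rat. t < of_rat q \<and> (\<forall>s\<in>A. t < s \<longrightarrow> of_rat q < s)" by blast
  from bchoice[OF this] obtain q :: "real \<Rightarrow> rat"
    where q: "\<forall>t\<in>?I. t < of_rat (q t) \<and> (\<forall>s\<in>A. t < s \<longrightarrow> of_rat (q t) < s)" by blast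
  have "inj_on q ?I"
  proof (rule linorder_inj_onI')
    fix s t assume st: "s \<in> ?I" "t \<in> ?I" "s < t"
    then have "t \<in> A" by blast
    then have "of_rat (q s) < t" "t < of_rat (q t)" using bspec[OF q st(1)] bspec[OF q st(2)] st(3) by blast+
    then show "q s \<noteq> q t" by auto
  qed
  then show ?thesis by (rule countableI')
qed

text \<open>The map \<open>uminus\<close> exchanges the two sides.\<close>

lemma countable_left_isolated:
  fixes A :: "real set"
  shows "countable {t \<in> A. \<exists>e>0. \<forall>s. t - e < s \<longrightarrow> s < t \<longrightarrow> s \<notin> A}"
    (is "countable ?I")
proof -
  have "uminus ` ?I \<subseteq> {t \<in> uminus ` A. \<exists>e>0. \<forall>s. t < s \<longrightarrow> s < t + e \<longrightarrow> s \<notin> uminus ` A}"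
  proof
    fix t assume "t \<in> uminus ` ?I"
    then obtain e where t: "- t \<in> A" "e > 0" and e: "\<And>s. - t - e < s \<Longrightarrow> s < - t \<Longrightarrow> s \<notin> A"
      by auto
    have "- s \<notin> A" if "t < s" "s < t + e" for s using e[of "- s"] that by simp
    then have "s \<notin> uminus ` A" if "t < s" "s < t + e" for s
      using that by (metis image_iff minus_minus)
    moreover have "t \<in> uminus ` A" using t(1) by (metis image_eqI minus_minus)
    ultimately show "t \<in> {t \<in> uminus ` A. \<exists>e>0. \<forall>s. t < s \<longrightarrow> s < t + e \<longrightarrow> s \<notin> uminus ` A}"
      using t(2) by blast
  qed
  then have "countable (uminus ` ?I)"
    using countable_right_isolated countable_subset by blast
  then show ?thesis by (simp add: countable_image_inj_eq)
qed

lemma isCont_gt: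
  fixes f :: "real \<Rightarrow> real"
  assumes "isCont f t" "c < f t"
  shows "\<exists>e>0. \<forall>s. dist s t < e \<longrightarrow> c < f s"
proof -
  obtain e where "e > 0" "\<And>s. dist s t < e \<Longrightarrow> dist (f s) (f t) < f t - c"
    using assms unfolding continuous_at_eps_delta by (metis diff_gt_0_iff_gt)
  then show ?thesis by (intro exI[of _ e]) (force simp: dist_real_def)
qed

text \<open>At a zero of the reflected path with positive drift the zero is isolated on the right; with
  negative drift the path sticks to zero, so the zero is interior or isolated on the left. Hence
  only countably many times are exceptional.\<close>

lemma reflect_derivative:
  assumes y: "\<And>s t. 0 \<le> s \<Longrightarrow> s \<le> t \<Longrightarrow> \<bar>y t - y s\<bar> \<le> B * (t - s)"
    and y': "\<And>t. 0 < t \<Longrightarrow> (y has_real_derivative b t) (at t)"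
    and b: "continuous_on {0<..} b"
  shows "\<exists>N. countable N \<and> (\<forall>t. 0 < t \<longrightarrow> t \<notin> N \<longrightarrow>
    (reflect y has_real_derivative (if 0 < reflect y t then b t else max 0 (b t))) (at t))"
proof -
  let ?x = "reflect y"
  define Z where "Z = {t. 0 < t \<and> ?x t = 0}"
  define N where "N = {t \<in> Z. \<exists>e>0. \<forall>s. t < s \<longrightarrow> s < t + e \<longrightarrow> s \<notin> Z}
    \<union> {t \<in> Z. \<exists>e>0. \<forall>s. t - e < s \<longrightarrow> s < t \<longrightarrow> s \<notin> Z}"
  have "countable N"
    unfolding N_def using countable_right_isolated countable_left_isolated by blast
  have x_cont: "isCont ?x t" and b_cont: "isCont b t" if "0 < t" for t
  proof -
    have "continuous_on {0<..} ?x"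
      by (rule continuous_on_subset[OF continuous_on_reflect[OF y]]) auto
    then show "isCont ?x t" using that by (simp add: continuous_on_eq_continuous_at)
    show "isCont b t" using that b by (simp add: continuous_on_eq_continuous_at)
  qed
  have mvt: "\<exists>z. s < z \<and> z < t \<and> y t - y s = (t - s) * b z" if "0 < s" "s < t" for s t
    using MVT2[of s t y b] y' that by force
  have "(?x has_real_derivative (if 0 < ?x t then b t else max 0 (b t))) (at t)"
    if t: "0 < t" "t \<notin> N" for t
  proof (cases "0 < ?x t")
    case True
    then obtain e' where e': "e' > 0" "\<And>s. dist s t < e' \<Longrightarrow> 0 < ?x s"
      using isCont_gt[OF x_cont[OF t(1)]] by blast
    define e where "e = min e' t"
    have e: "e > 0" "\<And>s. dist s t < e \<Longrightarrow> 0 < ?x s \<and> 0 < s"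
      using e' t(1) by (auto simp: e_def dist_real_def)
    \<comment> \<open>Away from zero no push occurs, so the reflected path is \<open>y\<close> plus
      a constant on both sides of \<open>t\<close>.\<close>
    have "?x s = y s + (?x t - y t)" if s: "s \<in> ball t e" for s
    proof (cases "s \<le> t")
      case True
      have "?x t - ?x s = y t - y s"
      proof (rule reflect_free[OF y])
        show "0 \<le> s" using e(2)[of s] s by (auto simp: dist_real_def abs_minus_commute)
        show "0 < ?x u" if "s < u" "u \<le> t" for u
          using e(2)[of u] s that by (auto simp: dist_real_def)
      qed (use True in auto)
      then show ?thesis by simp
    next
      case False
      have "?x s - ?x t = y s - y t"
      proof (rule reflect_free[OF y])
        show "0 < ?x u" if "t < u" "u \<le> s" for u
          using e(2)[of u] s that by (auto simp: dist_real_def)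
      qed (use False t in auto)
      then show ?thesis by simp
    qed
    note shift = this
    have "((\<lambda>s. y s + (?x t - y t)) has_real_derivative b t) (at t)"
      using y'[OF t(1)] by (auto intro!: derivative_eq_intros)
    then have "(?x has_real_derivative b t) (at t)"
    proof (rule has_field_derivative_transform_within_open[OF _ open_ball[of t e]])
      show "t \<in> ball t e" using e(1) by simp
      show "y s + (?x t - y t) = ?x s" if "s \<in> ball t e" for s
        by (rule shift[OF that, symmetric])
    qed
    with True show ?thesis by simp
  next
    case False
    then have zero: "?x t = 0" using reflect_nonneg[OF y, of t] t(1) by simp
    then have tZ: "t \<in> Z" using t by (simp add: Z_def)
    consider "0 < b t" | "b t < 0" | "b t = 0" by linarith
    then show ?thesis
    proof cases
      case 1
      obtain e where e: "e > 0" "\<And>s. dist s t < e \<Longrightarrow> 0 < b s"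
        using isCont_gt[OF b_cont[OF t(1)] 1] by blast
      have "s \<notin> Z" if ts: "t < s" "s < t + e" for s
      proof -
        obtain z where z: "t < z" "z < s" "y s - y t = (s - t) * b z" using mvt[of t s] t ts by blast
        then have "0 < y s - y t" using e(2)[of z] ts by (auto simp: dist_real_def)
        then have "0 < ?x s" using reflect_increment[OF y, of t s] zero t ts by simp
        then show ?thesis by (simp add: Z_def)
      qed
      then have "t \<in> N" using tZ e(1) unfolding N_def by blast
      with t(2) show ?thesis by simp
    next
      case 2
      obtain e where e: "e > 0" "\<And>s. dist s t < e \<Longrightarrow> b s < 0"
        using isCont_gt[OF isCont_minus[OF b_cont[OF t(1)]], of 0] 2 by auto
      \<comment> \<open>As \<open>t\<close> is not left isolated in \<open>Z\<close>, there is an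
        earlier zero \<open>s\<close> closer than \<open>e\<close>. Sticking starts there, so the
        path vanishes on a two-sided neighbourhood of \<open>t\<close>.\<close>
      obtain s where s: "t - e < s" "s < t" "s \<in> Z" using t(2) tZ e(1) unfolding N_def by blast
      have "?x r = 0" if r: "r \<in> {s<..<t + e}" for r
      proof -
        obtain u where u: "s \<le> u" "u \<le> r" "?x r = y r - y u"
          using reflect_last_zero[OF y, of s r] s r by (auto simp: Z_def)
        have "y r - y u \<le> 0"
        proof (cases "u = r")
          case False
          then obtain z where z: "u < z" "z < r" "y r - y u = (r - u) * b z"
            using mvt[of u r] u s by (auto simp: Z_def)
          then have "b z < 0" using e(2)[of z] u s r by (auto simp: dist_real_def)
          then show ?thesis using z by (simp add: mult_le_0_iff)
        qed simp
        then show ?thesis using u(3) reflect_nonneg[OF y, of r] s r by (auto simp: Z_def)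
      qed
      note sticks = this
      have "((\<lambda>_. 0) has_real_derivative 0) (at t)" by simp
      then have "(?x has_real_derivative 0) (at t)"
        by (rule has_field_derivative_transform_within_open[where S="{s<..<t + e}"])
          (use s e(1) sticks in auto)
      then show ?thesis using 2 zero by simp
    next
      case 3
      \<comment> \<open>With vanishing drift \<open>y\<close> is \<open>\<epsilon>\<close>-Lipschitz
        near \<open>t\<close>. To the left \<open>reflect_increment\<close> gives
        \<open>?x s \<le> y s - y t\<close>; to the right the path is an increment of
        \<open>y\<close> since its last zero. No time has to be discarded in this case.\<close>
      have "(?x has_derivative (\<lambda>h. 0 * h)) (at t)"
        unfolding has_derivative_at_alt
      proof (intro conjI allI impI)
        fix \<epsilon> :: real assume \<epsilon>: "\<epsilon> > 0"
        obtain e where e: "e > 0" "\<And>s. dist s t < e \<Longrightarrow> \<bar>b s\<bar> < \<epsilon>"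
          using b_cont[OF t(1)] 3 \<epsilon> unfolding continuous_at_eps_delta by (auto simp: dist_real_def)
        show "\<exists>d>0. \<forall>s. norm (s - t) < d \<longrightarrow> norm (?x s - ?x t - 0 * (s - t)) \<le> \<epsilon> * norm (s - t)"
        proof (intro exI conjI allI impI)
          show "0 < min e t" using e t by simp
          fix s assume s: "norm (s - t) < min e t"
          then have s0: "0 < s" by auto
          have bound: "\<bar>y r - y u\<bar> \<le> \<epsilon> * (r - u)" if ur: "u \<le> r" "0 < u" "dist u t < e" "dist r t < e" for u r
          proof (cases "u = r")
            case False
            then obtain z where z: "u < z" "z < r" "y r - y u = (r - u) * b z"
              using mvt[of u r] ur by auto
            then have "\<bar>b z\<bar> < \<epsilon>" using ur by (intro e(2)) (auto simp: dist_real_def)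
            then have "\<bar>b z\<bar> * (r - u) \<le> \<epsilon> * (r - u)" using ur by (intro mult_right_mono) auto
            then show ?thesis using z ur by (simp add: abs_mult mult.commute)
          qed simp
          have "\<bar>?x s\<bar> \<le> \<epsilon> * \<bar>s - t\<bar>"
          proof (cases "s \<le> t")
            case True
            have "?x s \<le> \<epsilon> * (t - s)"
              using reflect_increment[OF y, of s t] bound[of s t] zero s s0 True e(1)
              by (auto simp: dist_real_def)
            then show ?thesis using reflect_nonneg[OF y, of s] s0 True by simp
          next
            case False
            obtain u where u: "t \<le> u" "u \<le> s" "?x s = y s - y u"
              using reflect_last_zero[OF y, of t s] t zero False by auto
            have "y s - y u \<le> \<epsilon> * (s - u)"
              using bound[of u s] u t s by (auto simp: dist_real_def)
            also have "\<dots> \<le> \<epsilon> * (s - t)" using u \<epsilon> by (intro mult_left_mono) auto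
            finally show ?thesis using reflect_nonneg[OF y, of s] s0 u False by simp
          qed
          then show "norm (?x s - ?x t - 0 * (s - t)) \<le> \<epsilon> * norm (s - t)" using zero by simp
        qed
      qed (rule bounded_linear_mult_right)
      then have "(?x has_real_derivative 0) (at t)" by (simp only: has_field_derivative_def)
      then show ?thesis using 3 zero by simp
    qed
  qed
  with \<open>countable N\<close> show ?thesis by blast
qed

text \<open>Picard iteration in a weighted sup norm (Bielecki): a bounded function \<open>u\<close>
  stands for the path \<open>X u\<close>, and a large \<open>K\<close> makes the map a contraction
  on the whole half-line at once, without gluing short time steps.\<close>

lemma reflected_ode_exists:
  fixes b :: "real ^ 'n \<Rightarrow> real ^ 'n" and x0 :: "real ^ 'n"
  assumes b_lipschitz: "\<And>u v. norm (b u - b v) \<le> L * norm (u - v)" and L: "0 \<le> L"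
    and b_bounded: "\<And>u. norm (b u) \<le> B"
  shows "\<exists>x. continuous_on {0..} x \<and>
    (\<forall>t\<ge>0. \<forall>i. x t $ i = reflect (\<lambda>s. x0 $ i + integral {0..s} (\<lambda>r. b (x r) $ i)) t)"
proof -
  \<comment> \<open>The contraction factor will be \<open>2 * CARD('n) * L / K\<close>: 2 from
    \<open>reflect_stable\<close>, \<open>CARD('n)\<close> from the l1 norm, \<open>1 / K\<close>
    from integrating the weight. The factor 4 makes this at most 1/2; the added 1 ensures
    \<open>K \<ge> 1\<close>.\<close>
  define K where "K = 4 * CARD('n) * L + 1"
  have K: "1 \<le> K" using L by (simp add: K_def)
  have B: "0 \<le> B" using b_bounded[of 0] norm_ge_zero order_trans by blast
  define X where "X u s = exp (K * s) *\<^sub>R apply_bcontfun u s" for u :: "real \<Rightarrow>\<^sub>C (real ^ 'n)" and s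
  define Y where "Y u i t = x0 $ i + integral {0..t} (\<lambda>r. b (X u r) $ i)" for u i t
  have "L-lipschitz_on UNIV b"
    using b_lipschitz L by (intro lipschitz_onI) (auto simp: dist_norm)
  then have contb: "continuous_on UNIV b" by (rule lipschitz_on_continuous_on)
  have contX: "continuous_on S (X u)" for S u
    unfolding X_def by (intro continuous_intros) auto
  have contbX: "continuous_on S (\<lambda>r. b (X u r) $ i)" for S u i
    by (intro continuous_intros continuous_on_compose2[OF contb contX]) auto
  have intbX: "(\<lambda>r. b (X u r) $ i) integrable_on {s..t}" for u i s t
    by (rule integrable_continuous_real[OF contbX])
  have lipY: "\<bar>Y u i t - Y u i s\<bar> \<le> B * (t - s)" if "0 \<le> s" "s \<le> t" for u i s t
  proof -
    have "Y u i t - Y u i s = integral {s..t} (\<lambda>r. b (X u r) $ i)"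
      using Henstock_Kurzweil_Integration.integral_combine[OF that intbX, of u i] by (simp add: Y_def)
    moreover have "norm (integral {s..t} (\<lambda>r. b (X u r) $ i)) \<le> B * (t - s)"
      using component_le_norm_cart order_trans[OF _ b_bounded]
      by (intro integral_bound[OF \<open>s \<le> t\<close> contbX]) auto
    ultimately show ?thesis by simp
  qed
  \<comment> \<open>The path is frozen at negative times because bounded continuous functions live
    on the whole line.\<close>
  define \<Phi>' where "\<Phi>' u t = exp (- K * max 0 t) *\<^sub>R (\<chi> i. reflect (Y u i) (max 0 t))" for u t
  have "\<Phi>' u \<in> bcontfun" for u
    unfolding bcontfun_def
  proof (intro CollectI conjI)
    show "continuous_on UNIV (\<Phi>' u)"
      unfolding \<Phi>'_def
      by (intro continuous_intros continuous_on_compose2[OF continuous_on_reflect[OF lipY]]) auto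
    \<comment> \<open>A reflected path grows at most linearly, with rate \<open>2 * B\<close>; the
      weight absorbs this because \<open>s \<le> exp (K * s)\<close>.\<close>
    have "norm (\<Phi>' u t) \<le> (\<Sum>i\<in>UNIV. \<bar>x0 $ i\<bar> + 2 * B)" for t
    proof (rule order_trans[OF norm_le_l1_cart], rule sum_mono)
      fix i
      define s where "s = max 0 t"
      have s: "0 \<le> s" by (simp add: s_def)
      have "\<bar>reflect (Y u i) 0\<bar> \<le> \<bar>x0 $ i\<bar>"
        by (simp add: reflect_def push_def Y_def)
      moreover have "\<bar>reflect (Y u i) s - reflect (Y u i) 0\<bar> \<le> 2 * B * (s - 0)"
        by (rule reflect_lipschitz[OF lipY order_refl s])
      ultimately have "\<bar>reflect (Y u i) s\<bar> \<le> \<bar>x0 $ i\<bar> + 2 * B * s" by simp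
      moreover have "1 + K * s \<le> exp (K * s)" "1 * s \<le> K * s"
        by (rule exp_ge_add_one_self, rule mult_right_mono[OF K s])
      then have "s \<le> exp (K * s)" "1 \<le> exp (K * s)" using s by linarith+
      then have "\<bar>x0 $ i\<bar> * 1 + 2 * B * s \<le> \<bar>x0 $ i\<bar> * exp (K * s) + 2 * B * exp (K * s)"
        using B by (intro add_mono mult_left_mono) auto
      ultimately have "\<bar>reflect (Y u i) s\<bar> \<le> (\<bar>x0 $ i\<bar> + 2 * B) * exp (K * s)"
        by (simp add: algebra_simps)
      then show "\<bar>\<Phi>' u t $ i\<bar> \<le> \<bar>x0 $ i\<bar> + 2 * B"
        by (simp add: \<Phi>'_def s_def[symmetric] abs_mult exp_minus field_simps)
    qed
    then show "bounded (range (\<Phi>' u))" by (auto simp: bounded_iff)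
  qed
  define \<Phi> where "\<Phi> u = Bcontfun (\<Phi>' u)" for u
  have \<Phi>: "apply_bcontfun (\<Phi> u) = \<Phi>' u" for u
    unfolding \<Phi>_def by (rule Bcontfun_inverse) fact
  have "dist (\<Phi> u) (\<Phi> v) \<le> 1/2 * dist u v" for u v
  proof (rule dist_bound)
    fix t :: real
    define s where "s = max 0 t"
    have s: "0 \<le> s" by (simp add: s_def)
    define c where "c = L * dist u v / K * exp (K * s)"
    have close: "\<bar>Y u i r - Y v i r\<bar> \<le> c" if r: "0 \<le> r" "r \<le> s" for i r
    proof -
      have eq: "Y u i r - Y v i r = integral {0..r} (\<lambda>q. b (X u q) $ i - b (X v q) $ i)"
        by (simp add: Y_def integral_diff intbX)
      have int: "((\<lambda>q. L * dist u v * exp (K * q)) has_integral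
          (L * dist u v / K * exp (K * r) - L * dist u v / K * exp (K * 0))) {0..r}"
        using r(1)
      proof (rule fundamental_theorem_of_calculus)
        fix q
        have "((\<lambda>q. L * dist u v / K * exp (K * q)) has_real_derivative L * dist u v * exp (K * q)) (at q within {0..r})"
          using K by (auto intro!: derivative_eq_intros)
        then show "((\<lambda>q. L * dist u v / K * exp (K * q)) has_vector_derivative L * dist u v * exp (K * q)) (at q within {0..r})"
          by (simp add: has_real_derivative_iff_has_vector_derivative)
      qed
      have le: "norm (b (X u q) $ i - b (X v q) $ i) \<le> L * dist u v * exp (K * q)" for q
      proof -
        have "norm (b (X u q) $ i - b (X v q) $ i) \<le> norm (b (X u q) - b (X v q))"
          using component_le_norm_cart[of "b (X u q) - b (X v q)" i] by simp
        also have "\<dots> \<le> L * norm (X u q - X v q)" by (rule b_lipschitz)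
        also have "\<dots> = L * (exp (K * q) * dist (apply_bcontfun u q) (apply_bcontfun v q))"
          by (simp add: X_def dist_norm scaleR_diff_right[symmetric])
        also have "\<dots> \<le> L * (exp (K * q) * dist u v)"
          by (intro mult_left_mono dist_bounded L) simp
        finally show ?thesis by (simp add: mult_ac)
      qed
      have "norm (Y u i r - Y v i r) \<le> integral {0..r} (\<lambda>q. L * dist u v * exp (K * q))"
        unfolding eq
        by (intro Henstock_Kurzweil_Integration.integral_norm_bound_integral integrable_diff intbX
            has_integral_integrable[OF int] le)
      also have "\<dots> = L * dist u v / K * exp (K * r) - L * dist u v / K * exp (K * 0)"
        by (rule integral_unique[OF int])
      also have "\<dots> \<le> L * dist u v / K * exp (K * r)" using L K by simp
      also have "\<dots> \<le> c" unfolding c_def using L K r by (intro mult_left_mono) auto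
      finally show ?thesis by simp
    qed
    have "dist (\<Phi> u t) (\<Phi> v t) = exp (- K * s) * norm ((\<chi> i. reflect (Y u i) s) - (\<chi> i. reflect (Y v i) s))"
      by (simp add: \<Phi> \<Phi>'_def s_def[symmetric] dist_norm scaleR_diff_right[symmetric])
    also have "\<dots> \<le> exp (- K * s) * (\<Sum>i\<in>(UNIV::'n set). 2 * c)"
    proof (intro mult_left_mono order_trans[OF norm_le_l1_cart] sum_mono)
      fix i :: 'n
      show "\<bar>((\<chi> i. reflect (Y u i) s) - (\<chi> i. reflect (Y v i) s)) $ i\<bar> \<le> 2 * c"
        using reflect_stable[OF lipY lipY s close, of i] by simp
    qed simp
    also have "\<dots> = 2 * CARD('n) * L / K * dist u v"
      by (simp add: c_def exp_minus field_simps)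
    also have "\<dots> \<le> 1/2 * dist u v"
      using K by (intro mult_right_mono) (auto simp: K_def field_simps)
    finally show "dist (\<Phi> u t) (\<Phi> v t) \<le> 1/2 * dist u v" .
  qed
  then obtain u where u: "\<Phi> u = u"
    using banach_fix_type[of "1/2" \<Phi>] by auto
  have "X u t $ i = reflect (Y u i) t" if "0 \<le> t" for t i
  proof -
    have "X u t = exp (K * t) *\<^sub>R \<Phi>' u t"
      unfolding X_def by (subst u[symmetric]) (simp add: \<Phi>)
    also have "\<dots> = (\<chi> i. reflect (Y u i) t)"
      using that by (simp add: \<Phi>'_def max_def exp_minus)
    finally show ?thesis by simp
  qed
  then show ?thesis using contX unfolding Y_def by blast
qed

section \<open>Gradient flows of smooth convex energies on the orthant\<close>

lemma le_zero_if_le_linear: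
  fixes a c :: real
  assumes "\<epsilon> > 0" "\<And>s. 0 < s \<Longrightarrow> s \<le> \<epsilon> \<Longrightarrow> a \<le> c * s"
  shows "a \<le> 0"
proof (rule tendsto_lowerbound)
  show "((\<lambda>s. c * s) \<longlongrightarrow> 0) (at_right 0)"
    by (auto intro!: tendsto_eq_intros)
  show "eventually (\<lambda>s. a \<le> c * s) (at_right 0)"
    unfolding eventually_at_right_field using assms by (intro exI[of _ \<epsilon>]) auto
qed simp

text \<open>A two-sided Taylor bound replaces differentiability: it makes sense on the closed
  orthant, where boundary points allow only some increments, without extending \<open>g\<close>
  beyond it. The lower half is convexity with gradient \<open>G\<close>, the upper half bounds the
  curvature.\<close>

locale orthant_energy =
  fixes g :: "real ^ 'n \<Rightarrow> real" and G :: "real ^ 'n \<Rightarrow> real ^ 'n" and E :: "real ^ 'n \<Rightarrow> ereal"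
    and B C L :: real
  assumes E_eq: "E \<mu> = (if \<mu> \<in> orthant then ereal (g \<mu>) else \<infinity>)"
    and gradient_lower: "\<mu> \<in> orthant \<Longrightarrow> \<nu> \<in> orthant \<Longrightarrow> g \<mu> + G \<mu> \<bullet> (\<nu> - \<mu>) \<le> g \<nu>"
    and gradient_upper: "\<mu> \<in> orthant \<Longrightarrow> \<nu> \<in> orthant \<Longrightarrow> g \<nu> \<le> g \<mu> + G \<mu> \<bullet> (\<nu> - \<mu>) + C * (norm (\<nu> - \<mu>))\<^sup>2"
    and gradient_lipschitz: "\<mu> \<in> orthant \<Longrightarrow> \<nu> \<in> orthant \<Longrightarrow> norm (G \<nu> - G \<mu>) \<le> L * norm (\<nu> - \<mu>)"
    and gradient_bounded: "\<mu> \<in> orthant \<Longrightarrow> norm (G \<mu>) \<le> B"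
begin

section \<open>Computation of the minimal subgradient\<close>

definition slope :: "real ^ 'n \<Rightarrow> real ^ 'n"
  where "slope \<mu> = (\<chi> i. if 0 < \<mu> $ i then G \<mu> $ i else min 0 (G \<mu> $ i))"

lemma subdifferential_iff:
  assumes "\<mu> \<in> orthant"
  shows "v \<in> subdifferential E \<mu> \<longleftrightarrow> (\<forall>\<nu>\<in>orthant. g \<mu> + v \<bullet> (\<nu> - \<mu>) \<le> g \<nu>)"
  using assms by (auto simp: subdifferential_def E_eq)

lemma slope_subgradient:
  assumes \<mu>: "\<mu> \<in> orthant"
  shows "slope \<mu> \<in> subdifferential E \<mu>"
  unfolding subdifferential_iff[OF \<mu>]
proof
  fix \<nu> assume \<nu>: "\<nu> \<in> (orthant :: (real ^ 'n) set)"
  have "slope \<mu> $ i * (\<nu> $ i - \<mu> $ i) \<le> G \<mu> $ i * (\<nu> $ i - \<mu> $ i)" for i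
  proof (cases "0 < \<mu> $ i")
    case False
    moreover have "0 \<le> \<mu> $ i" "0 \<le> \<nu> $ i" using \<mu> \<nu> by (auto simp: orthant_def)
    ultimately have "\<mu> $ i = 0" "0 \<le> \<nu> $ i" by auto
    then show ?thesis by (auto simp: slope_def intro!: mult_right_mono)
  qed (simp add: slope_def)
  then have "slope \<mu> \<bullet> (\<nu> - \<mu>) \<le> G \<mu> \<bullet> (\<nu> - \<mu>)"
    by (simp add: inner_vec_def sum_mono)
  then show "g \<mu> + slope \<mu> \<bullet> (\<nu> - \<mu>) \<le> g \<nu>"
    using gradient_lower[OF \<mu> \<nu>] by linarith
qed

text \<open>Along a feasible segment the subgradient inequality meets the quadratic upper bound;
  dividing by \<open>s\<close> and letting it tend to 0 leaves the linear parts.\<close>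

lemma subgradient_direction:
  assumes \<mu>: "\<mu> \<in> orthant" and v: "v \<in> subdifferential E \<mu>"
    and "\<epsilon> > 0" and h: "\<And>s. 0 < s \<Longrightarrow> s \<le> \<epsilon> \<Longrightarrow> \<mu> + s *\<^sub>R h \<in> orthant"
  shows "v \<bullet> h \<le> G \<mu> \<bullet> h"
proof -
  have "v \<bullet> h - G \<mu> \<bullet> h \<le> (C * (norm h)\<^sup>2) * s" if s: "0 < s" "s \<le> \<epsilon>" for s
  proof -
    have "g \<mu> + s * (v \<bullet> h) \<le> g (\<mu> + s *\<^sub>R h)"
      using v h[OF s] unfolding subdifferential_iff[OF \<mu>] by force
    also have "\<dots> \<le> g \<mu> + s * (G \<mu> \<bullet> h) + C * (s\<^sup>2 * (norm h)\<^sup>2)"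
      using gradient_upper[OF \<mu> h[OF s]] by (simp add: power_mult_distrib)
    finally have "s * (v \<bullet> h - G \<mu> \<bullet> h) \<le> s * ((C * (norm h)\<^sup>2) * s)"
      by (simp add: algebra_simps power2_eq_square)
    with s(1) show ?thesis by simp
  qed
  from le_zero_if_le_linear[OF \<open>\<epsilon> > 0\<close> this] show ?thesis by simp
qed

text \<open>The direction \<open>axis i 1\<close> is always feasible, its negative only if
  \<open>\<mu> $ i\<close> is positive, and then for steps up to that value.\<close>

lemma subgradient_component:
  assumes \<mu>: "\<mu> \<in> orthant" and v: "v \<in> subdifferential E \<mu>"
  shows "v $ i \<le> G \<mu> $ i" and "0 < \<mu> $ i \<Longrightarrow> v $ i = G \<mu> $ i"
proof -
  have 1: "v \<bullet> axis i 1 \<le> G \<mu> \<bullet> axis i 1"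
    by (rule subgradient_direction[OF \<mu> v zero_less_one])
       (use \<mu> in \<open>auto simp: orthant_def axis_def\<close>)
  then show le: "v $ i \<le> G \<mu> $ i" by (simp add: inner_axis)
  assume pos: "0 < \<mu> $ i"
  have "v \<bullet> axis i (-1) \<le> G \<mu> \<bullet> axis i (-1)"
    by (rule subgradient_direction[OF \<mu> v pos])
       (use \<mu> in \<open>auto simp: orthant_def axis_def\<close>)
  then show "v $ i = G \<mu> $ i" using le by (simp add: inner_axis)
qed

text \<open>Subgradients are constrained coordinate by coordinate, so minimizing the norm decouples.
  The equality case yields the uniqueness that \<open>THE\<close> in \<open>min_subgradient\<close>
  demands.\<close>

lemma abs_slope_le:
  assumes \<mu>: "\<mu> \<in> orthant" and v: "v \<in> subdifferential E \<mu>"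
  shows "\<bar>slope \<mu> $ i\<bar> \<le> \<bar>v $ i\<bar>" and "\<bar>slope \<mu> $ i\<bar> = \<bar>v $ i\<bar> \<Longrightarrow> v $ i = slope \<mu> $ i"
  using subgradient_component[OF assms, of i] by (auto simp: slope_def min_def split: if_splits)

lemma min_subgradient_eq_slope:
  assumes \<mu>: "\<mu> \<in> orthant"
  shows "min_subgradient E \<mu> = slope \<mu>"
  unfolding min_subgradient_def
proof (rule the_equality)
  have le: "norm (slope \<mu>) \<le> norm v" if "v \<in> subdifferential E \<mu>" for v
    using abs_slope_le(1)[OF \<mu> that] by (intro norm_le_componentwise_cart) auto
  then show "is_arg_min norm (\<lambda>w. w \<in> subdifferential E \<mu>) (slope \<mu>)"
    using slope_subgradient[OF \<mu>] by (auto simp: is_arg_min_linorder)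
  fix v assume "is_arg_min norm (\<lambda>w. w \<in> subdifferential E \<mu>) v"
  then have v: "v \<in> subdifferential E \<mu>" and "norm v \<le> norm (slope \<mu>)"
    using slope_subgradient[OF \<mu>] by (auto simp: is_arg_min_linorder)
  then have "v \<bullet> v \<le> slope \<mu> \<bullet> slope \<mu>" by (simp add: norm_le)
  then have le_sum: "(\<Sum>i\<in>UNIV. (v $ i)\<^sup>2) \<le> (\<Sum>i\<in>UNIV. (slope \<mu> $ i)\<^sup>2)"
    by (simp add: inner_vec_def power2_eq_square)
  have comp: "(slope \<mu> $ i)\<^sup>2 \<le> (v $ i)\<^sup>2" for i
    using abs_slope_le(1)[OF \<mu> v] by (simp add: abs_le_square_iff)
  have "v $ i = slope \<mu> $ i" for i
  proof (rule ccontr)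
    assume "v $ i \<noteq> slope \<mu> $ i"
    then have "\<bar>slope \<mu> $ i\<bar> < \<bar>v $ i\<bar>"
      using abs_slope_le[OF \<mu> v, of i] by linarith
    then have "(slope \<mu> $ i)\<^sup>2 < (v $ i)\<^sup>2" 
      by (metis abs_ge_zero power2_abs power_strict_mono zero_less_numeral)
    then have "(\<Sum>i\<in>UNIV. (slope \<mu> $ i)\<^sup>2) < (\<Sum>i\<in>UNIV. (v $ i)\<^sup>2)"
      using comp by (intro sum_strict_mono_ex1) auto
    with le_sum show False by simp
  qed
  then show "v = slope \<mu>" by (simp add: vec_eq_iff)
qed

lemma slope_monotone:
  assumes "\<mu> \<in> orthant" "\<nu> \<in> orthant"
  shows "0 \<le> (slope \<mu> - slope \<nu>) \<bullet> (\<mu> - \<nu>)"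
proof -
  have "g \<mu> + slope \<mu> \<bullet> (\<nu> - \<mu>) \<le> g \<nu>" "g \<nu> + slope \<nu> \<bullet> (\<mu> - \<nu>) \<le> g \<mu>"
    using slope_subgradient[OF assms(1)] slope_subgradient[OF assms(2)] assms
    by (auto simp: subdifferential_iff)
  then show ?thesis by (simp add: inner_diff_left inner_diff_right)
qed

lemma has_derivative_energy:
  assumes \<mu>: "\<mu> \<in> orthant"
  shows "(g has_derivative (\<lambda>h. G \<mu> \<bullet> h)) (at \<mu> within orthant)"
  unfolding has_derivative_within_alt
proof (intro conjI allI impI bounded_linear_inner_right)
  fix e :: real assume e: "0 < e"
  have C: "0 \<le> max C 0" "C \<le> max C 0" by auto
  show "\<exists>d>0. \<forall>\<nu>\<in>orthant. norm (\<nu> - \<mu>) < d \<longrightarrow>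
      norm (g \<nu> - g \<mu> - G \<mu> \<bullet> (\<nu> - \<mu>)) \<le> e * norm (\<nu> - \<mu>)"
  proof (intro exI conjI ballI impI)
    show "0 < e / (max C 0 + 1)" using e C by (simp add: add_nonneg_pos)
    fix \<nu> assume \<nu>: "\<nu> \<in> (orthant :: (real ^ 'n) set)" and d: "norm (\<nu> - \<mu>) < e / (max C 0 + 1)"
    have "max C 0 + 1 > 0" using C by linarith
    then have d': "(max C 0 + 1) * norm (\<nu> - \<mu>) < e"
      using d by (simp add: pos_less_divide_eq mult.commute)
    have "\<bar>g \<nu> - g \<mu> - G \<mu> \<bullet> (\<nu> - \<mu>)\<bar> \<le> C * (norm (\<nu> - \<mu>))\<^sup>2"
      using gradient_lower[OF \<mu> \<nu>] gradient_upper[OF \<mu> \<nu>] by auto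
    also have "\<dots> \<le> ((max C 0 + 1) * norm (\<nu> - \<mu>)) * norm (\<nu> - \<mu>)"
      unfolding power2_eq_square mult.assoc by (intro mult_right_mono) auto
    also have "\<dots> \<le> e * norm (\<nu> - \<mu>)"
      using d' by (intro mult_right_mono) auto
    finally show "norm (g \<nu> - g \<mu> - G \<mu> \<bullet> (\<nu> - \<mu>)) \<le> e * norm (\<nu> - \<mu>)" by simp
  qed
qed

lemma continuous_on_energy: "continuous_on orthant g"
  using has_derivative_energy has_derivative_continuous continuous_on_eq_continuous_within by blast

lemma energy_chain_rule:
  assumes "(\<mu> has_vector_derivative v) (at t)" and "0 < t" and orth: "\<And>s. 0 \<le> s \<Longrightarrow> \<mu> s \<in> orthant"
  shows "((\<lambda>s. g (\<mu> s)) has_real_derivative G (\<mu> t) \<bullet> v) (at t)"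
proof -
  have "(\<mu> has_derivative (\<lambda>h. h *\<^sub>R v)) (at t within {0<..})"
    using assms(1) has_derivative_at_withinI unfolding has_vector_derivative_def by blast
  moreover have "(g has_derivative (\<lambda>h. G (\<mu> t) \<bullet> h)) (at (\<mu> t) within \<mu> ` {0<..})"
    using orth \<open>0 < t\<close> by (intro has_derivative_subset[OF has_derivative_energy]) auto
  ultimately have "(g \<circ> \<mu> has_derivative (\<lambda>h. G (\<mu> t) \<bullet> h) \<circ> (\<lambda>h. h *\<^sub>R v)) (at t within {0<..})"
    by (rule diff_chain_within)
  then have "(g \<circ> \<mu> has_derivative (\<lambda>h. G (\<mu> t) \<bullet> h) \<circ> (\<lambda>h. h *\<^sub>R v)) (at t)"
    using \<open>0 < t\<close> by (simp add: at_within_open[of t "{0<..}"])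
  then show ?thesis
    unfolding has_field_derivative_def comp_def by (simp add: mult_commute_abs)
qed

text \<open>Each entry of the slope is that of \<open>G \<mu>\<close> or 0. This turns the chain
  rule along the flow into the dissipation rate of the energy identity.\<close>

lemma gradient_inner_slope: "\<mu> \<in> orthant \<Longrightarrow> G \<mu> \<bullet> slope \<mu> = (norm (slope \<mu>))\<^sup>2"
  unfolding power2_norm_eq_inner inner_vec_def
  by (intro sum.cong) (auto simp: slope_def min_def)

end

section \<open>Contraction, uniqueness and convergence of energy solutions\<close>

context orthant_energy
begin

lemma energy_solution_velocity:
  assumes "energy_solution E \<mu>0 \<mu>"
  shows "\<exists>N. negligible N \<and>
    (\<forall>t. 0 < t \<longrightarrow> t \<notin> N \<longrightarrow> (\<mu> has_vector_derivative - slope (\<mu> t)) (at t))"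
proof -
  let ?P = "\<lambda>t. 0 < t \<longrightarrow> (\<mu> has_vector_derivative - min_subgradient E (\<mu> t)) (at t)"
  have "AE t in lebesgue. ?P t"
    using assms by (simp add: energy_solution_def solves_gradient_flow_def)
  then obtain N where "N \<in> null_sets lebesgue" and N: "{t \<in> space lebesgue. \<not> ?P t} \<subseteq> N"
    unfolding eventually_ae_filter by blast
  then have "negligible N" by (simp add: negligible_iff_null_sets)
  moreover have "(\<mu> has_vector_derivative - slope (\<mu> t)) (at t)" if "0 < t" "t \<notin> N" for t
    using N that assms min_subgradient_eq_slope[of "\<mu> t"] by (auto simp: energy_solution_def)
  ultimately show ?thesis by blast
qed

lemma energy_solution_orthant: "energy_solution E \<mu>0 \<mu> \<Longrightarrow> 0 \<le> t \<Longrightarrow> \<mu> t \<in> orthant"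
  by (simp add: energy_solution_def)

lemma energy_solution_absolutely_continuous:
  "energy_solution E \<mu>0 \<mu> \<Longrightarrow> 0 \<le> a \<Longrightarrow> a \<le> b \<Longrightarrow> absolutely_continuous_curve_on a b \<mu>"
  by (simp add: energy_solution_def locally_absolutely_continuous_def)

lemma energy_solution_contraction:
  assumes \<mu>: "energy_solution E \<mu>0 \<mu>" and \<nu>: "energy_solution E \<nu>0 \<nu>" and "0 \<le> s" "s \<le> t"
  shows "norm (\<mu> t - \<nu> t) \<le> norm (\<mu> s - \<nu> s)"
proof -
  obtain M where M: "negligible M"
    "\<And>t. 0 < t \<Longrightarrow> t \<notin> M \<Longrightarrow> (\<mu> has_vector_derivative - slope (\<mu> t)) (at t)"
    using energy_solution_velocity[OF \<mu>] by blast
  obtain N where N: "negligible N"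
    "\<And>t. 0 < t \<Longrightarrow> t \<notin> N \<Longrightarrow> (\<nu> has_vector_derivative - slope (\<nu> t)) (at t)"
    using energy_solution_velocity[OF \<nu>] by blast
  have "(norm (\<mu> t - \<nu> t))\<^sup>2 \<le> (norm (\<mu> s - \<nu> s))\<^sup>2"
  proof (rule absolutely_continuous_antimono[OF \<open>s \<le> t\<close>])
    show "negligible (M \<union> N)" using M N by auto
    show "absolutely_continuous_curve_on s t (\<lambda>r. (norm (\<mu> r - \<nu> r))\<^sup>2)"
      using assms by (intro absolutely_continuous_curve_norm_squared absolutely_continuous_curve_diff
          energy_solution_absolutely_continuous)
    fix r assume r: "s < r" "r < t" "r \<notin> M \<union> N"
    let ?D = "2 * ((\<mu> r - \<nu> r) \<bullet> (slope (\<nu> r) - slope (\<mu> r)))"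
    have \<mu>': "(\<mu> has_derivative (\<lambda>h. h *\<^sub>R - slope (\<mu> r))) (at r)"
      and \<nu>': "(\<nu> has_derivative (\<lambda>h. h *\<^sub>R - slope (\<nu> r))) (at r)"
      using M(2) N(2) r \<open>0 \<le> s\<close> by (auto simp: has_vector_derivative_def)
    have "((\<lambda>r. (\<mu> r - \<nu> r) \<bullet> (\<mu> r - \<nu> r)) has_derivative (\<lambda>h. ?D * h)) (at r)"
      by (auto intro!: derivative_eq_intros \<mu>' \<nu>' ext
          simp: inner_diff_left inner_diff_right inner_commute algebra_simps)
    then have "((\<lambda>r. (norm (\<mu> r - \<nu> r))\<^sup>2) has_real_derivative ?D) (at r)"
      by (simp add: has_field_derivative_def power2_norm_eq_inner)
    moreover have "?D \<le> 0"
      using slope_monotone[of "\<mu> r" "\<nu> r"] energy_solution_orthant[OF \<mu>] energy_solution_orthant[OF \<nu>]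
        r \<open>0 \<le> s\<close> by (simp add: inner_diff_left inner_diff_right inner_commute)
    ultimately show "\<exists>D\<le>0. ((\<lambda>r. (norm (\<mu> r - \<nu> r))\<^sup>2) has_real_derivative D) (at r)" by blast
  qed
  then show ?thesis by simp
qed

lemma energy_solution_unique:
  assumes "energy_solution E \<mu>0 \<mu>" "energy_solution E \<mu>0 \<nu>" "0 \<le> t"
  shows "\<mu> t = \<nu> t"
  using energy_solution_contraction[OF assms(1,2) order_refl assms(3)] assms(1,2)
  by (simp add: energy_solution_def)

text \<open>Lets \<open>energy_solution_contraction\<close> compare a solution with a minimizer. At
  a minimizer 0 is a subgradient, and the slope is entrywise no larger in modulus than any
  subgradient.\<close>

lemma stationary_energy_solution:
  assumes m: "m \<in> orthant" and min: "\<And>\<nu>. \<nu> \<in> orthant \<Longrightarrow> g m \<le> g \<nu>"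
  shows "energy_solution E m (\<lambda>t. m)"
proof -
  have "0 \<in> subdifferential E m" using min m by (simp add: subdifferential_iff)
  then have "slope m $ i = 0" for i using abs_slope_le(1)[OF m, of 0 i] by simp
  then have "min_subgradient E m = 0"
    using m by (simp add: min_subgradient_eq_slope vec_eq_iff)
  then show ?thesis
    using m by (auto simp: energy_solution_def locally_absolutely_continuous_def
        absolutely_continuous_curve_const solves_gradient_flow_def energy_identity_def
        set_integrable_def set_lebesgue_integral_def)
qed

lemma energy_solution_energy_antimono:
  assumes \<mu>: "energy_solution E \<mu>0 \<mu>" and "0 \<le> s" "s \<le> t"
  shows "g (\<mu> t) \<le> g (\<mu> s)"
proof -
  let ?f = "\<lambda>s. (norm (min_subgradient E (\<mu> s)))\<^sup>2"
  have E_g: "E (\<mu> r) = ereal (g (\<mu> r))" if "0 \<le> r" for r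
    using energy_solution_orthant[OF \<mu> that] by (simp add: E_eq)
  have id: "?f integrable_on {0..r} \<and> g (\<mu> r) = g (\<mu> 0) - integral {0..r} ?f" if "0 \<le> r" for r
  proof (cases "r = 0")
    \<comment> \<open>\<open>energy_identity\<close> speaks of positive times only.\<close>
    case True
    then show ?thesis using integrable_on_refl[of ?f 0] by simp
  next
    case False
    then have "set_integrable lebesgue {0..r} ?f"
      and "E (\<mu> r) = E (\<mu> 0) - ereal (LINT s:{0..r}|lebesgue. ?f s)"
      using \<mu> that by (auto simp: energy_solution_def energy_identity_def)
    then show ?thesis
      using that by (simp add: E_g set_lebesgue_integral_eq_integral)
  qed
  have "integral {0..s} ?f \<le> integral {0..t} ?f"
    using id[of s] id[of t] assms(2,3) by (intro integral_subset_le) auto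
  then show ?thesis using id[of s] id[of t] assms(2,3) by simp
qed

text \<open>\<open>(norm (\<mu> r - m))\<^sup>2 + r * c\<close> is a Lyapunov function: its
  derivative is at most \<open>2 * (g m - g (\<mu> r)) + c\<close>, and
  \<open>g (\<mu> T) \<le> g (\<mu> r)\<close>. Freezing the energy at the final time makes the
  second term linear in \<open>r\<close>, so \<open>g\<close> is never differentiated along the
  curve.\<close>

lemma energy_solution_rate:
  assumes \<mu>: "energy_solution E \<mu>0 \<mu>" and m: "m \<in> orthant" and "0 \<le> T"
  shows "T * (g (\<mu> T) - g m) \<le> (norm (\<mu>0 - m))\<^sup>2 / 2"
proof -
  define c where "c = 2 * (g (\<mu> T) - g m)"
  obtain N where N: "negligible N"
    "\<And>t. 0 < t \<Longrightarrow> t \<notin> N \<Longrightarrow> (\<mu> has_vector_derivative - slope (\<mu> t)) (at t)"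
    using energy_solution_velocity[OF \<mu>] by blast
  have "(norm (\<mu> T - m))\<^sup>2 + T * c \<le> (norm (\<mu> 0 - m))\<^sup>2 + 0 * c"
  proof (rule absolutely_continuous_antimono[OF \<open>0 \<le> T\<close> _ N(1)])
    show "absolutely_continuous_curve_on 0 T (\<lambda>r. (norm (\<mu> r - m))\<^sup>2 + r * c)"
      by (intro absolutely_continuous_curve_norm_squared absolutely_continuous_curve_diff
          absolutely_continuous_curve_const absolutely_continuous_curve_add
          energy_solution_absolutely_continuous[OF \<mu>] order_refl \<open>0 \<le> T\<close>
          absolutely_continuous_curve_linear[OF absolutely_continuous_curve_id] bounded_linear_mult_left)
    fix r assume r: "0 < r" "r < T" "r \<notin> N"
    let ?D = "2 * ((\<mu> r - m) \<bullet> - slope (\<mu> r)) + c"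
    have \<mu>': "(\<mu> has_derivative (\<lambda>h. h *\<^sub>R - slope (\<mu> r))) (at r)"
      using N(2) r by (auto simp: has_vector_derivative_def)
    have "((\<lambda>r. (\<mu> r - m) \<bullet> (\<mu> r - m) + r * c) has_derivative (\<lambda>h. ?D * h)) (at r)"
      by (auto intro!: derivative_eq_intros \<mu>' ext
          simp: inner_diff_left inner_diff_right inner_commute algebra_simps)
    then have "((\<lambda>r. (norm (\<mu> r - m))\<^sup>2 + r * c) has_real_derivative ?D) (at r)"
      by (simp add: has_field_derivative_def power2_norm_eq_inner)
    moreover have "?D \<le> 0"
    proof -
      have \<mu>r: "\<mu> r \<in> orthant" using energy_solution_orthant[OF \<mu>] r by simp
      have "g (\<mu> r) + slope (\<mu> r) \<bullet> (m - \<mu> r) \<le> g m"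
        using slope_subgradient[OF \<mu>r] m by (simp add: subdifferential_iff[OF \<mu>r])
      moreover have "g (\<mu> T) \<le> g (\<mu> r)"
        using energy_solution_energy_antimono[OF \<mu>, of r T] r by simp
      ultimately show ?thesis
        by (simp add: c_def inner_diff_left inner_diff_right inner_commute)
    qed
    ultimately show "\<exists>D\<le>0. ((\<lambda>r. (norm (\<mu> r - m))\<^sup>2 + r * c) has_real_derivative D) (at r)" by blast
  qed
  moreover have "\<mu> 0 = \<mu>0" using \<mu> by (simp add: energy_solution_def)
  ultimately have "(norm (\<mu> T - m))\<^sup>2 + T * c \<le> (norm (\<mu>0 - m))\<^sup>2" by simp
  then have "T * c \<le> (norm (\<mu>0 - m))\<^sup>2"
    using zero_le_power2[of "norm (\<mu> T - m)"] by linarith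
  then show ?thesis by (simp add: c_def algebra_simps)
qed

text \<open>The distance to \<open>m\<close> never grows, so the curve has a cluster point
  \<open>l\<close>, and the rate makes \<open>l\<close> a minimizer. Then the distance to
  \<open>l\<close> itself never grows, which turns convergence along a subsequence into convergence
  of the whole curve (Fejer monotonicity). The last step needs \<open>l\<close> rather than
  \<open>m\<close>, as there may be several minimizers.\<close>

lemma energy_solution_converges:
  assumes \<mu>: "energy_solution E \<mu>0 \<mu>"
    and m: "m \<in> orthant" and min: "\<And>\<nu>. \<nu> \<in> orthant \<Longrightarrow> g m \<le> g \<nu>"
  shows "\<exists>l. (\<mu> \<longlongrightarrow> l) at_top \<and> is_arg_min E (\<lambda>\<nu>. \<nu> \<in> orthant) l"
proof -
  define K where "K = cball m (norm (\<mu>0 - m)) \<inter> orthant"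
  have "closed (orthant :: (real ^ 'n) set)"
    unfolding orthant_def by (intro closed_Collect_all closed_Collect_le continuous_intros)
  then have "compact K" unfolding K_def by (intro compact_Int_closed compact_cball)
  moreover have in_K: "\<mu> (real k) \<in> K" for k
    using energy_solution_contraction[OF \<mu> stationary_energy_solution[OF m min], of 0 "real k"] \<mu>
      energy_solution_orthant[OF \<mu>, of "real k"]
    by (auto simp: K_def energy_solution_def dist_norm norm_minus_commute)
  ultimately have "\<exists>l\<in>K. \<exists>r. strict_mono r \<and> ((\<lambda>k. \<mu> (real k)) \<circ> r) \<longlonglongrightarrow> l"
    unfolding compact_def by (elim allE[of _ "\<lambda>k. \<mu> (real k)"]) simp
  then obtain l r where l: "l \<in> K" and r: "strict_mono r" and lim: "(\<lambda>k. \<mu> (real (r k))) \<longlonglongrightarrow> l"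
    unfolding comp_def by blast
  have l_orth: "l \<in> orthant" using l by (simp add: K_def)
  have "(\<lambda>k. g (\<mu> (real (r k)))) \<longlonglongrightarrow> g l"
    by (rule continuous_on_tendsto_compose[OF continuous_on_energy lim l_orth])
       (simp add: energy_solution_orthant[OF \<mu>])
  moreover have "(\<lambda>k. g m + ((norm (\<mu>0 - m))\<^sup>2 / 2) / real (r k)) \<longlonglongrightarrow> g m + 0"
    by (intro tendsto_add tendsto_const tendsto_divide_0[OF tendsto_const]
        filterlim_at_top_imp_at_infinity filterlim_compose[OF filterlim_real_sequentially]
        filterlim_subseq r)
  moreover have "\<forall>\<^sub>F k in sequentially. g (\<mu> (real (r k))) \<le> g m + ((norm (\<mu>0 - m))\<^sup>2 / 2) / real (r k)"
    using eventually_gt_at_top[of 0]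
  proof eventually_elim
    case (elim k)
    then have "0 < real (r k)" using seq_suble[OF r, of k] by simp
    then show ?case
      using energy_solution_rate[OF \<mu> m, of "real (r k)"] by (simp add: field_simps)
  qed
  ultimately have "g l \<le> g m + 0"
    by (intro tendsto_le[OF sequentially_bot])
  then have l_min: "g l \<le> g \<nu>" if "\<nu> \<in> orthant" for \<nu> using min[OF that] by simp
  have "(\<mu> \<longlongrightarrow> l) at_top"
  proof (rule tendstoI)
    fix e :: real assume "0 < e"
    then obtain k where k: "dist (\<mu> (real (r k))) l < e"
      using lim by (auto simp: lim_sequentially)
    show "\<forall>\<^sub>F t in at_top. dist (\<mu> t) l < e"
      using eventually_ge_at_top[of "real (r k)"]
    proof eventually_elim
      case (elim t)
      have "norm (\<mu> t - l) \<le> norm (\<mu> (real (r k)) - l)"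
        by (rule energy_solution_contraction[OF \<mu> stationary_energy_solution[OF l_orth l_min] _ elim]) auto
      with k show ?case by (simp add: dist_norm)
    qed
  qed
  moreover have "is_arg_min E (\<lambda>\<nu>. \<nu> \<in> orthant) l"
    using l_orth l_min by (auto simp: is_arg_min_linorder E_eq)
  ultimately show ?thesis by blast
qed

end

section \<open>Existence: from the reflected equation to an energy solution\<close>

lemma has_vector_derivative_componentwise_cart:
  fixes f :: "real \<Rightarrow> real ^ 'n"
  assumes "\<And>i. ((\<lambda>s. f s $ i) has_real_derivative v $ i) (at t)"
  shows "(f has_vector_derivative v) (at t)"
  unfolding has_vector_derivative_def
proof (subst has_derivative_componentwise_within, safe)
  fix e :: "real ^ 'n" assume "e \<in> Basis"
  then obtain i where e: "e = axis i 1" by (auto simp: Basis_vec_def)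
  show "((\<lambda>s. f s \<bullet> e) has_derivative (\<lambda>h. (h *\<^sub>R v) \<bullet> e)) (at t)"
    using assms[of i] by (simp add: e inner_axis has_field_derivative_def mult_commute_abs)
qed

lemma countable_imp_AE_lebesgue:
  fixes N :: "real set"
  assumes "countable N" "\<And>t. t \<notin> N \<Longrightarrow> P t"
  shows "AE t in lebesgue. P t"
proof -
  have "N \<in> null_sets lebesgue"
    using countable_imp_null_set_lborel[OF assms(1)] by (rule null_sets_completionI)
  then show ?thesis
    by (rule AE_I') (use assms(2) in auto)
qed

context orthant_energy
begin

text \<open>\<open>gradient_lower\<close> at either end controls the increment from one side. This
  makes \<open>g\<close> absolutely continuous along a Lipschitz curve.\<close>

lemma energy_lipschitz:
  assumes "\<mu> \<in> orthant" "\<nu> \<in> orthant"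
  shows "\<bar>g \<nu> - g \<mu>\<bar> \<le> B * norm (\<nu> - \<mu>)"
proof -
  have "\<bar>G \<eta> \<bullet> v\<bar> \<le> B * norm v" if "\<eta> \<in> orthant" for \<eta> v
    by (rule order_trans[OF Cauchy_Schwarz_ineq2 mult_right_mono[OF gradient_bounded[OF that]]]) simp
  from this[OF assms(1), of "\<nu> - \<mu>"] this[OF assms(2), of "\<mu> - \<nu>", unfolded norm_minus_commute[of \<mu>]]
  show ?thesis
    using gradient_lower[OF assms] gradient_lower[OF assms(2,1)]
    by linarith
qed

lemma energy_solution_if_lipschitz:
  fixes x :: "real \<Rightarrow> real ^ 'n"
  assumes orth: "\<And>t. 0 \<le> t \<Longrightarrow> x t \<in> orthant"
    and lip: "\<And>s t. 0 \<le> s \<Longrightarrow> s \<le> t \<Longrightarrow> norm (x t - x s) \<le> K * (t - s)"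
    and N: "countable N"
    and x': "\<And>t. 0 < t \<Longrightarrow> t \<notin> N \<Longrightarrow> (x has_vector_derivative - slope (x t)) (at t)"
  shows "energy_solution E (x 0) x"
proof -
  have ac: "absolutely_continuous_curve_on a b x" if "0 \<le> a" for a b
    using lip that by (intro absolutely_continuous_curve_dominated[OF absolutely_continuous_curve_id, where C=K]) auto
  have flow: "AE t in lebesgue. 0 < t \<longrightarrow> (x has_vector_derivative - min_subgradient E (x t)) (at t)"
    by (rule countable_imp_AE_lebesgue[OF N]) (simp add: x' min_subgradient_eq_slope orth)
  have "energy_identity E x"
    unfolding energy_identity_def
  proof (intro allI impI)
    fix t :: real assume t: "0 < t"
    let ?f = "\<lambda>s. (norm (min_subgradient E (x s)))\<^sup>2"
    have "((\<lambda>s. - ?f s) has_integral (g (x t) - g (x 0))) {0..t}"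
    proof (rule fundamental_theorem_of_calculus_absolutely_continuous)
      show "absolutely_continuous_curve_on 0 t (\<lambda>s. g (x s))"
        by (rule absolutely_continuous_curve_dominated[OF ac[of 0 t], where C=B])
          (auto intro!: energy_lipschitz orth)
      \<comment> \<open>The flow equation is given at positive times, so 0 joins the exceptional
        set.\<close>
      show "negligible (insert 0 N)" 
        using null_sets_completionI[OF countable_imp_null_set_lborel[OF N]]
        by (simp add: negligible_iff_null_sets[symmetric])
      fix s assume s: "s \<in> {0..t} - insert 0 N"
      then have "((\<lambda>s. g (x s)) has_real_derivative G (x s) \<bullet> - slope (x s)) (at s)"
        by (intro energy_chain_rule x' orth) auto
      then show "((\<lambda>s. g (x s)) has_vector_derivative - ?f s) (at s within {0..t})"
        using s orth[of s]
        by (auto simp: min_subgradient_eq_slope gradient_inner_slope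
            has_real_derivative_iff_has_vector_derivative intro: has_vector_derivative_at_within)
    qed (use t in simp)
    from has_integral_neg[OF this] have int: "(?f has_integral (g (x 0) - g (x t))) {0..t}"
      by simp
    \<comment> \<open>For a nonnegative function gauge integrability implies Lebesgue integrability,
      so measurability of the slope along the curve comes for free.\<close>
    then have set_int: "set_integrable lebesgue {0..t} ?f"
      by (intro nonnegative_absolutely_integrable_1) auto
    then show "set_integrable lebesgue {0..t} ?f \<and> E (x t) = E (x 0) - ereal (LINT s:{0..t}|lebesgue. ?f s)"
      using t orth[of t] orth[of 0] integral_unique[OF int]
      by (simp add: E_eq set_lebesgue_integral_eq_integral(2))
  qed
  moreover have "AE t in lebesgue. 0 < t \<longrightarrow> x differentiable at t"
    using flow by eventually_elim (auto simp: has_vector_derivative_def differentiable_def)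
  ultimately show ?thesis
    using ac flow orth
    by (simp add: energy_solution_def locally_absolutely_continuous_def solves_gradient_flow_def)
qed

lemma energy_solution_exists:
  assumes \<mu>0: "\<mu>0 \<in> orthant"
  shows "\<exists>\<mu>. energy_solution E \<mu>0 \<mu>"
proof -
  \<comment> \<open>The nearest point map of the orthant is nonexpansive, so it extends the drift to
    the whole space as a bounded Lipschitz field. Along the reflected path it is the
    identity.\<close>
  define P where "P u = (\<chi> i. max 0 (u $ i))" for u :: "real ^ 'n"
  define b where "b u = - G (P u)" for u
  have P_orth: "P u \<in> orthant" for u by (simp add: P_def orthant_def)
  have P_id: "P u = u" if "u \<in> orthant" for u
    using that by (simp add: P_def orthant_def vec_eq_iff)
  have "norm (P u - P v) \<le> norm (u - v)" for u v
    by (rule norm_le_componentwise_cart) (auto simp: P_def)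
  moreover have "norm (G (P u) - G (P v)) \<le> \<bar>L\<bar> * norm (P u - P v)" for u v
    using gradient_lipschitz[OF P_orth P_orth] by (meson abs_ge_self mult_right_mono norm_ge_zero order_trans)
  ultimately have b_lip: "norm (b u - b v) \<le> \<bar>L\<bar> * norm (u - v)" for u v
    unfolding b_def by (smt (verit) abs_ge_zero minus_diff_minus mult_left_mono norm_minus_cancel)
  have b_bdd: "norm (b u) \<le> B" for u
    by (simp add: b_def gradient_bounded P_orth)
  obtain x where contx: "continuous_on {0..} x"
    and x: "\<And>t i. 0 \<le> t \<Longrightarrow> x t $ i = reflect (\<lambda>s. \<mu>0 $ i + integral {0..s} (\<lambda>r. b (x r) $ i)) t"
    using reflected_ode_exists[OF b_lip abs_ge_zero b_bdd, of \<mu>0] by blast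
  define y where "y i s = \<mu>0 $ i + integral {0..s} (\<lambda>r. b (x r) $ i)" for i s
  have x_eq: "x t $ i = reflect (y i) t" if "0 \<le> t" for t i
    using x[OF that] by (simp add: y_def[abs_def])
  have "\<bar>L\<bar>-lipschitz_on UNIV b"
    using b_lip by (intro lipschitz_onI) (auto simp: dist_norm)
  then have contb: "continuous_on UNIV b" by (rule lipschitz_on_continuous_on)
  have contbx: "continuous_on S (\<lambda>r. b (x r) $ i)" if "S \<subseteq> {0..}" for S i
    by (intro continuous_intros continuous_on_compose2[OF contb continuous_on_subset[OF contx that]]) auto
  have lipy: "\<bar>y i t - y i s\<bar> \<le> B * (t - s)" if st: "0 \<le> s" "s \<le> t" for i s t
  proof -
    have "y i t - y i s = integral {s..t} (\<lambda>r. b (x r) $ i)"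
      using Henstock_Kurzweil_Integration.integral_combine[OF st integrable_continuous_real[OF contbx], of i] by (simp add: y_def)
    moreover have "norm (integral {s..t} (\<lambda>r. b (x r) $ i)) \<le> B * (t - s)"
      using component_le_norm_cart order_trans[OF _ b_bdd] st
      by (intro integral_bound[OF \<open>s \<le> t\<close> contbx]) auto
    ultimately show ?thesis by simp
  qed
  have y': "(y i has_real_derivative b (x t) $ i) (at t)" if t: "0 < t" for i t
  proof -
    \<comment> \<open>The end point \<open>t+1\<close> makes \<open>t\<close> interior, so the
      derivative within the interval is the full one.\<close>
    have "((\<lambda>s. integral {0..s} (\<lambda>r. b (x r) $ i)) has_real_derivative b (x t) $ i) (at t within {0..t+1})"
      using t by (intro integral_has_real_derivative contbx) auto
    then have "((\<lambda>s. integral {0..s} (\<lambda>r. b (x r) $ i)) has_real_derivative b (x t) $ i) (at t)"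
      using t by (simp add: at_within_Icc_at)
    then show ?thesis unfolding y_def[abs_def] by (auto intro!: derivative_eq_intros)
  qed
  have x_orth: "x t \<in> orthant" if "0 \<le> t" for t
    using reflect_nonneg[OF lipy that] by (simp add: orthant_def x_eq[OF that])
  define D where "D i t = (if 0 < reflect (y i) t then b (x t) $ i else max 0 (b (x t) $ i))" for i t
  define Q where "Q i M \<longleftrightarrow> countable M \<and>
    (\<forall>t. 0 < t \<longrightarrow> t \<notin> M \<longrightarrow> (reflect (y i) has_real_derivative D i t) (at t))" for i M
  have sub: "{0<..} \<subseteq> {0::real..}" by auto
  have "\<exists>M. Q i M" for i
    unfolding Q_def D_def by (rule reflect_derivative[OF lipy y' contbx[OF sub]])
  then have "\<exists>N. \<forall>i. Q i (N i)" by (intro choice allI)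
  then obtain N where Q: "\<And>i. Q i (N i)" by blast
  have N: "countable (N i)" for i using Q[of i] by (simp add: Q_def)
  have refl': "(reflect (y i) has_real_derivative D i t) (at t)" if "0 < t" "t \<notin> N i" for i t
    using Q[of i] that by (simp add: Q_def)
  have "energy_solution E (x 0) x"
  proof (rule energy_solution_if_lipschitz[OF x_orth])
    show "countable (\<Union>i. N i)" using N by simp
    fix t assume t: "0 < t" "t \<notin> (\<Union>i. N i)"
    show "(x has_vector_derivative - slope (x t)) (at t)"
    proof (rule has_vector_derivative_componentwise_cart)
      fix i
      \<comment> \<open>On a face \<open>max 0 (- z) = - min 0 z\<close> with \<open>z\<close> the
        entry of \<open>G\<close>: reflecting the drift is the same as cutting the positive part of
        the gradient.\<close>
      have "D i t = (- slope (x t)) $ i"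
        using t x_eq[of t i] P_id[OF x_orth[of t]] by (auto simp: slope_def b_def D_def min_def max_def)
      then have "(reflect (y i) has_real_derivative (- slope (x t)) $ i) (at t)"
        using refl'[of t i] t by simp
      then show "((\<lambda>s. x s $ i) has_real_derivative (- slope (x t)) $ i) (at t)"
      proof (rule has_field_derivative_transform_within_open[where S="{0<..}"])
        show "t \<in> {0<..}" using t by simp
        show "reflect (y i) s = x s $ i" if "s \<in> {0<..}" for s
          using x_eq[of s i] that by simp
      qed simp
    qed
  next
    fix s t :: real assume st: "0 \<le> s" "s \<le> t"
    have "norm (x t - x s) \<le> (\<Sum>i\<in>(UNIV::'n set). 2 * B * (t - s))"
    proof (rule order_trans[OF norm_le_l1_cart], rule sum_mono)
      fix i
      show "\<bar>(x t - x s) $ i\<bar> \<le> 2 * B * (t - s)"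
        using reflect_lipschitz[OF lipy st, of i] st by (simp add: x_eq)
    qed
    then show "norm (x t - x s) \<le> (CARD('n) * (2 * B)) * (t - s)" by (simp add: mult.assoc)
  qed
  moreover have "x 0 = \<mu>0"
    using \<mu>0 by (simp add: vec_eq_iff x_eq reflect_def push_def y_def orthant_def)
  ultimately show ?thesis by auto
qed

end

section \<open>The compliance energy\<close>

text \<open>\<open>K_definite\<close> states definiteness of the sum as triviality of the common
  null vectors, the form in which the cells deliver it. \<open>d_pos\<close> keeps coercivity
  uniform down to the boundary of the orthant, \<open>a_pos\<close> bounds the sublevel
  sets.\<close>

locale compliance =
  fixes K :: "'n::finite \<Rightarrow> real ^ 'm::finite ^ 'm" and F :: "real ^ 'm" and a :: "real ^ 'n" and d :: real
  assumes K_symmetric: "u \<bullet> (K i *v v) = v \<bullet> (K i *v u)"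
    and K_nonneg: "0 \<le> v \<bullet> (K i *v v)"
    and K_definite: "(\<And>i. v \<bullet> (K i *v v) = 0) \<Longrightarrow> v = 0"
    and d_pos: "0 < d"
    and a_pos: "0 < a $ i"
begin

definition A :: "real ^ 'n \<Rightarrow> real ^ 'm ^ 'm"
  where "A \<mu> = (\<Sum>i\<in>UNIV. (\<mu> $ i + d) *\<^sub>R K i)"

definition w :: "real ^ 'n \<Rightarrow> real ^ 'm"
  where "w \<mu> = matrix_inv (A \<mu>) *v F"

definition g :: "real ^ 'n \<Rightarrow> real"
  where "g \<mu> = F \<bullet> w \<mu> + \<mu> \<bullet> a"

definition G :: "real ^ 'n \<Rightarrow> real ^ 'n"
  where "G \<mu> = (\<chi> i. a $ i - w \<mu> \<bullet> (K i *v w \<mu>))"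

text \<open>The derivative of the affine map \<open>A\<close> in direction \<open>\<eta>\<close>,
  applied to \<open>v\<close>.\<close>

definition D :: "real ^ 'n \<Rightarrow> real ^ 'm \<Rightarrow> real ^ 'm"
  where "D \<eta> v = (\<Sum>i\<in>UNIV. \<eta> $ i *\<^sub>R (K i *v v))"

lemma A_mult: "A \<mu> *v v = (\<Sum>i\<in>UNIV. (\<mu> $ i + d) *\<^sub>R (K i *v v))"
proof -
  have "sum f S *v v = (\<Sum>i\<in>S. f i *v v)" if "finite S" for f :: "'n \<Rightarrow> real ^ 'm ^ 'm" and S
    using that by induction (simp_all add: matrix_vector_mult_add_rdistrib)
  then show ?thesis by (simp add: A_def scaleR_matrix_vector_assoc)
qed

lemma A_diff: "A \<nu> *v v - A \<mu> *v v = D (\<nu> - \<mu>) v"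
  by (simp add: A_mult D_def sum_subtractf[symmetric] scaleR_diff_left[symmetric])

lemma A_symmetric: "u \<bullet> (A \<mu> *v v) = v \<bullet> (A \<mu> *v u)"
  by (simp add: A_mult inner_sum_right K_symmetric[of u])

lemma D_symmetric: "u \<bullet> D \<eta> v = v \<bullet> D \<eta> u"
  by (simp add: D_def inner_sum_right K_symmetric[of u])

text \<open>All weights \<open>\<mu> $ i + d\<close> are at least \<open>d\<close> and all forms are
  nonnegative, so the form dominates \<open>d\<close> times the unweighted sum \<open>q\<close>. The
  latter has a positive minimum on the unit sphere, and homogeneity extends the bound to all
  vectors.\<close>

lemma coercive: "\<exists>\<alpha>>0. \<forall>\<mu>\<in>orthant. \<forall>v. \<alpha> * (norm v)\<^sup>2 \<le> v \<bullet> (A \<mu> *v v)"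
proof -
  define q where "q v = (\<Sum>i\<in>UNIV. v \<bullet> (K i *v v))" for v
  have "axis undefined 1 \<in> sphere (0::real ^ 'm) 1" by (simp add: norm_axis_1)
  then have "sphere (0::real ^ 'm) 1 \<noteq> {}" by blast
  moreover have "continuous_on (sphere (0::real ^ 'm) 1) q"
    unfolding q_def by (intro continuous_intros linear_continuous_on_compose matrix_vector_mul_linear)
  ultimately obtain v0 where v0: "norm v0 = 1" and le: "\<And>v. norm v = 1 \<Longrightarrow> q v0 \<le> q v"
    using continuous_attains_inf[OF compact_sphere] by (metis mem_sphere_0)
  have "v0 \<noteq> 0" using v0 by auto
  then obtain i where "v0 \<bullet> (K i *v v0) \<noteq> 0" using K_definite by blast
  then have "q v0 \<noteq> 0" using K_nonneg unfolding q_def by (auto simp: sum_nonneg_eq_0_iff)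
  then have pos: "0 < q v0" using K_nonneg unfolding q_def by (simp add: less_le sum_nonneg)
  have "d * q v0 * (norm v)\<^sup>2 \<le> v \<bullet> (A \<mu> *v v)" if \<mu>: "\<mu> \<in> orthant" for \<mu> v
  proof (cases "v = 0")
    case False
    define u where "u = v /\<^sub>R norm v"
    have v: "v = norm v *\<^sub>R u" using False by (simp add: u_def)
    have "q v0 \<le> q u" using False by (intro le) (simp add: u_def)
    then have "d * (q v0 * (norm v)\<^sup>2) \<le> d * (q u * (norm v)\<^sup>2)"
      using d_pos by (intro mult_left_mono mult_right_mono) auto
    also have "q u * (norm v)\<^sup>2 = q (norm v *\<^sub>R u)"
      by (simp add: q_def sum_distrib_right matrix_vector_mult_scaleR power2_eq_square mult_ac sum_distrib_left)
    also have "\<dots> = q v" by (simp only: v[symmetric])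
    also have "d * q v \<le> v \<bullet> (A \<mu> *v v)"
      unfolding q_def A_mult inner_sum_right sum_distrib_left
      using \<mu> K_nonneg by (intro sum_mono) (auto simp: orthant_def intro!: mult_right_mono)
    finally show ?thesis by (simp add: mult.assoc)
  qed simp
  then show ?thesis using pos d_pos by (intro exI[of _ "d * q v0"]) auto
qed

definition \<alpha> :: real
  where "\<alpha> = (SOME \<alpha>. 0 < \<alpha> \<and> (\<forall>\<mu>\<in>orthant. \<forall>v. \<alpha> * (norm v)\<^sup>2 \<le> v \<bullet> (A \<mu> *v v)))"

lemma \<alpha>_pos: "0 < \<alpha>"
  and A_coercive: "\<mu> \<in> orthant \<Longrightarrow> \<alpha> * (norm v)\<^sup>2 \<le> v \<bullet> (A \<mu> *v v)"
  using someI_ex[OF coercive] unfolding \<alpha>_def by auto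

text \<open>Coercivity makes the kernel trivial; only for an invertible matrix is
  \<open>matrix_inv\<close>, defined by choice, the actual inverse.\<close>

lemma A_w: assumes \<mu>: "\<mu> \<in> orthant" shows "A \<mu> *v w \<mu> = F"
proof -
  have "v = 0" if "A \<mu> *v v = 0" for v
    using A_coercive[OF \<mu>, of v] that \<alpha>_pos
    by (simp add: mult_le_0_iff)
  then have "invertible (A \<mu>)"
    by (simp add: invertible_left_inverse matrix_left_invertible_ker)
  then show ?thesis
    unfolding w_def matrix_inv_def invertible_def matrix_vector_mul_assoc
    by (metis (mono_tags, lifting) matrix_vector_mul_lid someI_ex)
qed

definition k :: real
  where "k = (\<Sum>i\<in>UNIV. onorm ((*v) (K i)))"

lemma k_nonneg: "0 \<le> k"
  unfolding k_def by (intro sum_nonneg onorm_pos_le matrix_vector_mul_bounded_linear)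

lemma norm_K_le: "norm (K i *v v) \<le> k * norm v"
proof -
  have "norm (K i *v v) \<le> onorm ((*v) (K i)) * norm v"
    by (rule onorm[OF matrix_vector_mul_bounded_linear])
  also have "\<dots> \<le> k * norm v"
    unfolding k_def
    by (intro mult_right_mono member_le_sum onorm_pos_le matrix_vector_mul_bounded_linear) auto
  finally show ?thesis .
qed

lemma norm_D_le: "norm (D \<eta> v) \<le> (CARD('n) * k) * norm \<eta> * norm v"
proof -
  have "norm (D \<eta> v) \<le> (\<Sum>i\<in>(UNIV::'n set). norm \<eta> * (k * norm v))"
    unfolding D_def
  proof (rule sum_norm_le)
    show "norm (\<eta> $ i *\<^sub>R (K i *v v)) \<le> norm \<eta> * (k * norm v)" for i
      using component_le_norm_cart[of \<eta> i] norm_K_le[of i v] by (simp add: mult_mono)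
  qed
  then show ?thesis by (simp add: algebra_simps)
qed

definition W :: real where "W = norm F / \<alpha>"

text \<open>The equation is tested with its own solution, and one factor of the norm is
  cancelled.\<close>

lemma norm_w_le: assumes \<mu>: "\<mu> \<in> orthant" shows "norm (w \<mu>) \<le> W"
proof (cases "w \<mu> = 0")
  case False
  have "\<alpha> * (norm (w \<mu>))\<^sup>2 \<le> w \<mu> \<bullet> F"
    using A_coercive[OF \<mu>, of "w \<mu>"] by (simp add: A_w[OF \<mu>])
  also have "\<dots> \<le> norm (w \<mu>) * norm F" by (rule norm_cauchy_schwarz)
  finally have "norm (w \<mu>) * (\<alpha> * norm (w \<mu>)) \<le> norm (w \<mu>) * norm F"
    by (simp add: power2_eq_square algebra_simps)
  then show ?thesis using False \<alpha>_pos by (simp add: W_def field_simps)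
qed (use \<alpha>_pos in \<open>simp add: W_def\<close>)

lemma W_nonneg: "0 \<le> W"
  using \<alpha>_pos by (simp add: W_def)

definition R :: real where "R = CARD('n) * k * W"

lemma R_nonneg: "0 \<le> R"
  using k_nonneg W_nonneg by (simp add: R_def)

lemma norm_D_w_le: assumes \<mu>: "\<mu> \<in> orthant" shows "norm (D \<eta> (w \<mu>)) \<le> R * norm \<eta>"
proof -
  have "norm (D \<eta> (w \<mu>)) \<le> (CARD('n) * k) * norm \<eta> * W"
    using norm_D_le[of \<eta> "w \<mu>"] norm_w_le[OF \<mu>] k_nonneg
    by (meson mult_left_mono mult_nonneg_nonneg norm_ge_zero of_nat_0_le_iff order_trans)
  then show ?thesis by (simp add: R_def algebra_simps)
qed

text \<open>Both states carry the same load \<open>F\<close>, so only the change of the matrix,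
  applied to the old state, remains.\<close>

lemma A_w_diff: assumes "\<mu> \<in> orthant" "\<nu> \<in> orthant"
  shows "A \<nu> *v (w \<nu> - w \<mu>) = - D (\<nu> - \<mu>) (w \<mu>)"
  using A_diff[of \<nu> "w \<mu>" \<mu>] assms
  by (simp add: matrix_vector_mult_diff_distrib A_w) (metis minus_diff_eq)

lemma w_lipschitz: assumes "\<mu> \<in> orthant" "\<nu> \<in> orthant"
  shows "norm (w \<nu> - w \<mu>) \<le> R / \<alpha> * norm (\<nu> - \<mu>)"
proof (cases "w \<nu> = w \<mu>")
  case False
  define e where "e = w \<nu> - w \<mu>"
  have "\<alpha> * (norm e)\<^sup>2 \<le> e \<bullet> - D (\<nu> - \<mu>) (w \<mu>)"
    using A_coercive[OF assms(2), of e] A_w_diff[OF assms] by (simp add: e_def)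
  also have "\<dots> \<le> norm e * norm (D (\<nu> - \<mu>) (w \<mu>))"
    using norm_cauchy_schwarz[of e "- D (\<nu> - \<mu>) (w \<mu>)"] by simp
  also have "\<dots> \<le> norm e * (R * norm (\<nu> - \<mu>))"
    by (intro mult_left_mono norm_D_w_le assms) simp
  finally have "norm e * (\<alpha> * norm e) \<le> norm e * (R * norm (\<nu> - \<mu>))"
    by (simp add: power2_eq_square algebra_simps)
  then show ?thesis using False \<alpha>_pos by (simp add: e_def field_simps)
qed (use \<alpha>_pos R_nonneg in simp)

lemma G_inner: "G \<mu> \<bullet> \<eta> = a \<bullet> \<eta> - w \<mu> \<bullet> D \<eta> (w \<mu>)"
  by (simp add: G_def D_def inner_vec_def[of a] inner_vec_def[of "vec_lambda _"] inner_sum_right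
      right_diff_distrib sum_subtractf mult.commute)

lemma g_expansion: assumes "\<mu> \<in> orthant" "\<nu> \<in> orthant"
  shows "g \<nu> - g \<mu> - G \<mu> \<bullet> (\<nu> - \<mu>) = (w \<nu> - w \<mu>) \<bullet> (A \<nu> *v (w \<nu> - w \<mu>))"
    (is "?Q = _")
proof -
  define e where "e = w \<nu> - w \<mu>"
  define D' where "D' = D (\<nu> - \<mu>)"
  have "G \<mu> \<bullet> (\<nu> - \<mu>) = a \<bullet> (\<nu> - \<mu>) - w \<mu> \<bullet> D' (w \<mu>)"
    unfolding D'_def by (rule G_inner)
  then have "?Q = F \<bullet> e + w \<mu> \<bullet> D' (w \<mu>)"
    by (simp add: g_def e_def inner_diff_right inner_diff_left inner_commute)
  \<comment> \<open>The load is replaced through the equation at \<open>\<mu>\<close> and moved onto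
    \<open>e\<close> by symmetry. Then \<open>A \<mu>\<close> is traded for \<open>A \<nu>\<close>,
    because \<open>A_w_diff\<close> evaluates the latter on \<open>e\<close>; the terms of first
    order cancel.\<close>
  also have "F \<bullet> e = w \<mu> \<bullet> (A \<mu> *v e)"
    using A_w[OF assms(1)] A_symmetric[of "w \<mu>" \<mu> e] by (simp add: inner_commute)
  also have "A \<mu> *v e = A \<nu> *v e - D' e"
    using A_diff[of \<nu> e \<mu>] by (simp add: D'_def algebra_simps)
  also have "A \<nu> *v e = - D' (w \<mu>)"
    using A_w_diff[OF assms] by (simp add: e_def D'_def)
  also have "w \<mu> \<bullet> (- D' (w \<mu>) - D' e) + w \<mu> \<bullet> D' (w \<mu>) = - (w \<mu> \<bullet> D' e)"
    by (simp add: inner_diff_right)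
  also have "w \<mu> \<bullet> D' e = e \<bullet> D' (w \<mu>)"
    unfolding D'_def by (rule D_symmetric)
  also have "- (e \<bullet> D' (w \<mu>)) = e \<bullet> (A \<nu> *v e)"
    using A_w_diff[OF assms] by (simp add: e_def D'_def)
  finally show ?thesis by (simp add: e_def)
qed

text \<open>By symmetry the difference of the two squares factors as \<open>e\<close> against the
  sum of the states, which explains the 2. It controls one entry of the increment of
  \<open>G\<close>.\<close>

lemma quadratic_lipschitz:
  assumes "\<mu> \<in> orthant" "\<nu> \<in> orthant"
  shows "\<bar>w \<nu> \<bullet> (K i *v w \<nu>) - w \<mu> \<bullet> (K i *v w \<mu>)\<bar> \<le> 2 * k * W * (R / \<alpha>) * norm (\<nu> - \<mu>)"
proof -
  define e where "e = w \<nu> - w \<mu>"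
  have bound: "\<bar>e \<bullet> (K i *v w \<eta>)\<bar> \<le> k * W * (R / \<alpha>) * norm (\<nu> - \<mu>)" if "\<eta> \<in> orthant" for \<eta>
  proof -
    have "\<bar>e \<bullet> (K i *v w \<eta>)\<bar> \<le> norm e * norm (K i *v w \<eta>)" by (rule Cauchy_Schwarz_ineq2)
    also have "\<dots> \<le> (R / \<alpha> * norm (\<nu> - \<mu>)) * (k * W)"
    proof (rule mult_mono)
      show "norm e \<le> R / \<alpha> * norm (\<nu> - \<mu>)" unfolding e_def by (rule w_lipschitz[OF assms])
      show "norm (K i *v w \<eta>) \<le> k * W"
        using norm_K_le[of i "w \<eta>"] norm_w_le[OF that] k_nonneg
        by (meson mult_left_mono order_trans)
    qed (use R_nonneg \<alpha>_pos in auto)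
    finally show ?thesis by (simp add: algebra_simps)
  qed
  have "w \<nu> \<bullet> (K i *v w \<nu>) - w \<mu> \<bullet> (K i *v w \<mu>) = e \<bullet> (K i *v w \<nu>) + e \<bullet> (K i *v w \<mu>)"
    using K_symmetric[of "w \<mu>" i "w \<nu>"]
    by (simp add: e_def inner_diff_left)
  then show ?thesis using bound[OF assms(1)] bound[OF assms(2)] by linarith
qed

text \<open>The remainder in \<open>g_expansion\<close> is nonnegative by coercivity and at most the
  product of \<open>R / \<alpha>\<close>, the Lipschitz constant of the state, and \<open>R\<close>,
  the bound for \<open>A \<nu>\<close> on the difference of states. The other two constants sum
  entrywise bounds through the l1 norm.\<close>

lemma is_orthant_energy:
  fixes E
  assumes E: "\<And>\<mu>. E \<mu> = (if \<mu> \<in> orthant then ereal (g \<mu>) else \<infinity>)"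
  shows "orthant_energy g G E (\<Sum>i\<in>UNIV. a $ i + k * W\<^sup>2) (R * (R / \<alpha>)) (CARD('n) * (2 * k * W * (R / \<alpha>)))"
proof
  fix \<mu> \<nu> :: "real ^ 'n" assume \<mu>: "\<mu> \<in> orthant" and \<nu>: "\<nu> \<in> orthant"
  have "0 \<le> \<alpha> * (norm (w \<nu> - w \<mu>))\<^sup>2" using \<alpha>_pos by simp
  also have "\<dots> \<le> (w \<nu> - w \<mu>) \<bullet> (A \<nu> *v (w \<nu> - w \<mu>))" by (rule A_coercive[OF \<nu>])
  finally show "g \<mu> + G \<mu> \<bullet> (\<nu> - \<mu>) \<le> g \<nu>"
    using g_expansion[OF \<mu> \<nu>] by simp
  have "(w \<nu> - w \<mu>) \<bullet> (A \<nu> *v (w \<nu> - w \<mu>)) \<le> norm (w \<nu> - w \<mu>) * norm (A \<nu> *v (w \<nu> - w \<mu>))"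
    by (rule norm_cauchy_schwarz)
  also have "\<dots> \<le> (R / \<alpha> * norm (\<nu> - \<mu>)) * (R * norm (\<nu> - \<mu>))"
    using norm_D_w_le[OF \<mu>, of "\<nu> - \<mu>"] R_nonneg \<alpha>_pos
    by (intro mult_mono w_lipschitz \<mu> \<nu>) (auto simp: A_w_diff[OF \<mu> \<nu>])
  finally show "g \<nu> \<le> g \<mu> + G \<mu> \<bullet> (\<nu> - \<mu>) + R * (R / \<alpha>) * (norm (\<nu> - \<mu>))\<^sup>2"
    using g_expansion[OF \<mu> \<nu>] by (simp add: power2_eq_square algebra_simps)
  have "norm (G \<nu> - G \<mu>) \<le> (\<Sum>i\<in>UNIV. \<bar>(G \<nu> - G \<mu>) $ i\<bar>)" by (rule norm_le_l1_cart)
  also have "\<dots> \<le> (\<Sum>i\<in>(UNIV::'n set). 2 * k * W * (R / \<alpha>) * norm (\<nu> - \<mu>))"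
    using quadratic_lipschitz[OF \<mu> \<nu>] by (intro sum_mono) (simp add: G_def abs_minus_commute)
  finally show "norm (G \<nu> - G \<mu>) \<le> CARD('n) * (2 * k * W * (R / \<alpha>)) * norm (\<nu> - \<mu>)"
    by (simp add: mult.assoc)
next
  fix \<mu> :: "real ^ 'n" assume \<mu>: "\<mu> \<in> orthant"
  have "\<bar>G \<mu> $ i\<bar> \<le> a $ i + k * W\<^sup>2" for i
  proof -
    have "\<bar>w \<mu> \<bullet> (K i *v w \<mu>)\<bar> \<le> norm (w \<mu>) * norm (K i *v w \<mu>)" by (rule Cauchy_Schwarz_ineq2)
    also have "\<dots> \<le> W * (k * W)"
      using norm_w_le[OF \<mu>] norm_K_le[of i "w \<mu>"] k_nonneg W_nonneg
      by (intro mult_mono order_trans[OF norm_K_le] mult_left_mono) auto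
    finally show ?thesis using a_pos[of i] by (simp add: G_def power2_eq_square algebra_simps)
  qed
  then show "norm (G \<mu>) \<le> (\<Sum>i\<in>UNIV. a $ i + k * W\<^sup>2)"
    by (intro order_trans[OF norm_le_l1_cart] sum_mono)
qed (rule E)

text \<open>The compliance \<open>F \<bullet> w \<mu>\<close> is nonnegative, so
  \<open>g \<mu> \<le> g 0\<close> bounds \<open>\<mu> \<bullet> a\<close> by \<open>g 0\<close> and
  each entry by \<open>g 0 / a $ i\<close>. The sublevel set therefore lies in a compact
  box.\<close>

lemma minimizer_exists: "\<exists>m\<in>orthant. \<forall>\<nu>\<in>orthant. g m \<le> g \<nu>"
proof -
  interpret orthant_energy g G "\<lambda>\<mu>. if \<mu> \<in> orthant then ereal (g \<mu>) else \<infinity>"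
    "\<Sum>i\<in>UNIV. a $ i + k * W\<^sup>2" "R * (R / \<alpha>)" "CARD('n) * (2 * k * W * (R / \<alpha>))"
    by (rule is_orthant_energy) simp
  have zero: "0 \<in> (orthant :: (real ^ 'n) set)" by (simp add: orthant_def)
  define S where "S = cbox 0 (\<chi> i. g 0 / a $ i)"
  have S_orthant: "S \<subseteq> orthant" by (auto simp: S_def orthant_def mem_box_cart)
  have sublevel: "\<mu> \<in> S" if \<mu>: "\<mu> \<in> orthant" "g \<mu> \<le> g 0" for \<mu>
  proof -
    have "0 \<le> \<alpha> * (norm (w \<mu>))\<^sup>2" using \<alpha>_pos by simp
    also have "\<dots> \<le> F \<bullet> w \<mu>"
      using A_coercive[OF \<mu>(1), of "w \<mu>"] by (simp add: A_w[OF \<mu>(1)] inner_commute)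
    finally have "\<mu> \<bullet> a \<le> g 0" using \<mu>(2) by (simp add: g_def)
    moreover have "\<mu> $ i * a $ i \<le> \<mu> \<bullet> a" for i
      unfolding inner_vec_def inner_real_def
      using \<mu>(1) a_pos by (intro member_le_sum) (auto simp: orthant_def less_imp_le)
    ultimately have "\<mu> $ i \<le> g 0 / a $ i" for i
      using a_pos[of i] by (simp add: pos_le_divide_eq) (meson order_trans)
    then show ?thesis using \<mu>(1) by (simp add: S_def mem_box_cart orthant_def)
  qed
  have "\<exists>m\<in>S. \<forall>\<nu>\<in>S. g m \<le> g \<nu>"
    using sublevel[OF zero order_refl]
    by (intro continuous_attains_inf continuous_on_subset[OF continuous_on_energy S_orthant])
       (auto simp: S_def)
  then obtain m where m: "m \<in> S" "\<And>\<nu>. \<nu> \<in> S \<Longrightarrow> g m \<le> g \<nu>" by blast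
  have "g m \<le> g \<nu>" if "\<nu> \<in> orthant" for \<nu>
    using m(2)[OF sublevel[OF zero order_refl]] m(2)[OF sublevel[OF that]] by linarith
  then show ?thesis using m(1) S_orthant by blast
qed

end

section \<open>The finite element stiffness matrices\<close>

lemma grad_eqI:
  assumes "GDERIV u x :> D"
  shows "grad u x = D"
  unfolding grad_def
proof (rule the_equality)
  show "GDERIV u x :> D" by (rule assms)
next
  fix D' assume "GDERIV u x :> D'"
  then have "(\<lambda>h. h \<bullet> D') = (\<lambda>h. h \<bullet> D)"
    using assms unfolding gderiv_def by (rule has_derivative_unique)
  then have "(D' - D) \<bullet> (D' - D) = 0" unfolding inner_diff_right by (metis diff_self)
  then show "D' = D" by simp
qed

lemma grad_affine:
  assumes "open U" "x \<in> U" and "\<And>y. y \<in> U \<Longrightarrow> u y = g \<bullet> y + c"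
  shows "grad u x = g"
proof (rule grad_eqI)
  have "((\<lambda>y. g \<bullet> y + c) has_derivative (\<lambda>h. h \<bullet> g)) (at x)"
    by (auto intro!: derivative_eq_intros simp: inner_commute)
  then show "GDERIV u x :> g"
    unfolding gderiv_def
    by (rule has_derivative_transform_within_open[OF _ assms(1,2)]) (simp add: assms(3))
qed

lemma stiffness_symmetric: "u \<bullet> (stiffness X \<phi> *v v) = v \<bullet> (stiffness X \<phi> *v u)"
proof -
  have "transpose (stiffness X \<phi>) = stiffness X \<phi>"
    by (simp add: stiffness_def transpose_def vec_eq_iff inner_commute)
  then show ?thesis
    by (metis dot_lmul_matrix inner_commute transpose_matrix_vector)
qed

section \<open>Cells, skeleton and integrability of piecewise functions\<close>

context
  fixes \<T> :: "(real ^ 'd) set set"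
  assumes \<T>: "triangulation_of_Omega \<T>"
begin

lemma finite_triangulation: "finite \<T>"
  using \<T> by (simp add: triangulation_of_Omega_def triangulation_def)

lemma Union_triangulation: "\<Union>\<T> = cbox 0 1"
  using \<T> by (simp add: triangulation_of_Omega_def Omega_def interval_ne_empty_cart)

lemma Omega_subset_Union: "Omega \<subseteq> \<Union>\<T>"
  unfolding Union_triangulation Omega_def by (rule box_subset_cbox)

text \<open>A simplex of full affine dimension has its relative interior as interior. It lies in the
  closed cube, whose interior is \<open>Omega\<close>.\<close>

lemma triangulation_element:
  assumes "S \<in> \<T>"
  shows "compact S" "convex S" "interior S \<noteq> {}" "S \<subseteq> cbox 0 1" "interior S \<subseteq> Omega" "\<not> negligible S"
proof -
  have S: "int CARD('d) simplex S" using \<T> assms by (simp add: triangulation_of_Omega_def)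
  show c: "compact S" "convex S" using S compact_simplex convex_simplex by auto
  have "aff_dim S = int DIM(real ^ 'd)" using aff_dim_simplex[OF S] by simp
  then show i: "interior S \<noteq> {}"
    using rel_interior_eq_empty[OF c(2)] by (auto simp: interior_rel_interior_gen)
  show sub: "S \<subseteq> cbox 0 1" using assms Union_triangulation by blast
  then show "interior S \<subseteq> Omega"
    unfolding Omega_def by (metis interior_cbox interior_mono)
  show "\<not> negligible S" using i negligible_convex_interior[OF c(2)] by simp
qed

lemma negligible_skeleton: "negligible (\<Union>S\<in>\<T>. frontier S)"
  using finite_triangulation triangulation_element(2) negligible_convex_frontier
  by (intro negligible_Union) auto

text \<open>The missed points lie on frontiers of convex sets. Integrals over \<open>X\<close> thus
  see only open cells, while nothing is known about \<open>grad\<close> on the skeleton.\<close>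

lemma cell_cover:
  assumes "X \<subseteq> cbox 0 1"
  shows "negligible (X - (\<Union>S\<in>\<T>. X \<inter> interior S))"
proof (rule negligible_subset[OF negligible_skeleton], rule subsetI)
  fix x assume x: "x \<in> X - (\<Union>S\<in>\<T>. X \<inter> interior S)"
  then have "x \<in> \<Union>\<T>" unfolding Union_triangulation using assms by auto
  then obtain S where S: "S \<in> \<T>" "x \<in> S" by (rule UnionE)
  then have "x \<in> frontier S"
    using x closure_subset[of S] by (auto simp: frontier_def)
  with S(1) show "x \<in> (\<Union>S\<in>\<T>. frontier S)" by (rule UN_I)
qed

text \<open>\<open>X\<close> is general because two meshes meet: in the application it is a simplex
  of \<open>\<T> n\<close>, while the cells, on which the basis is affine, belong to
  \<open>\<T> (Suc n)\<close>.\<close>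

lemma integrable_piecewise_constant:
  fixes h :: "real ^ 'd \<Rightarrow> real"
  assumes X: "X \<in> lmeasurable" "X \<subseteq> cbox 0 1"
    and h: "\<And>S. S \<in> \<T> \<Longrightarrow> \<exists>c. \<forall>x\<in>interior S. h x = c"
  shows "h absolutely_integrable_on X"
proof -
  have "h absolutely_integrable_on (\<Union>S\<in>\<T>. X \<inter> interior S)"
  proof (rule set_integrable_UN[OF finite_triangulation])
    fix S assume S: "S \<in> \<T>"
    have meas: "X \<inter> interior S \<in> lmeasurable"
      using X(1) by (intro fmeasurable.Int lmeasurable_interior compact_imp_bounded
          triangulation_element(1)[OF S])
    then show "X \<inter> interior S \<in> sets lebesgue" by auto
    obtain c where "\<forall>x\<in>interior S. h x = c" using h[OF S] by blast
    then show "h absolutely_integrable_on (X \<inter> interior S)"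
      using absolutely_integrable_on_const[OF meas, of c]
      by (subst set_integrable_cong[OF refl refl, of _ _ "\<lambda>x. c"]) auto
  qed
  then show ?thesis
  proof (rule absolutely_integrable_spike_set)
    show "negligible {x \<in> X - (\<Union>S\<in>\<T>. X \<inter> interior S). h x \<noteq> 0}"
      by (rule negligible_subset[OF cell_cover[OF X(2)]]) auto
    show "negligible {x \<in> (\<Union>S\<in>\<T>. X \<inter> interior S) - X. h x \<noteq> 0}"
      by (rule negligible_subset[OF negligible_empty]) auto
  qed
qed

text \<open>The same \<open>g\<close> governs the gradient inside and the values on all of
  \<open>S \<inter> Omega\<close>. This link lets \<open>stiffness_definite\<close> pass from
  vanishing gradients to constant values.\<close>

lemma P1_grad_constant:
  assumes u: "u \<in> P1_zero_mean \<T>" and S: "S \<in> \<T>"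
  shows "\<exists>g c. (\<forall>x\<in>S \<inter> Omega. u x = g \<bullet> x + c) \<and> (\<forall>x\<in>interior S. grad u x = g)"
proof -
  obtain g c where gc: "\<forall>x\<in>S \<inter> Omega. u x = g \<bullet> x + c"
    using u S unfolding P1_zero_mean_def by blast
  have "interior S \<subseteq> S \<inter> Omega"
    using triangulation_element(5)[OF S] interior_subset[of S] by simp
  then have "grad u x = g" if "x \<in> interior S" for x
    using gc by (intro grad_affine[OF open_interior that, where c=c]) auto
  then show ?thesis using gc by blast
qed

lemma Omega_lmeasurable: "(Omega :: (real ^ 'd) set) \<in> lmeasurable"
  by (simp add: Omega_def)

text \<open>Continuity on the open cube does not give integrability by itself; being affine on
  finitely many compact pieces does.\<close>

lemma integrable_P1:
  assumes u: "u \<in> P1_zero_mean \<T>"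
  shows "u absolutely_integrable_on Omega"
proof -
  have "u absolutely_integrable_on (\<Union>S\<in>\<T>. S \<inter> Omega)"
  proof (rule set_integrable_UN[OF finite_triangulation])
    fix S assume S: "S \<in> \<T>"
    show meas: "S \<inter> Omega \<in> sets lebesgue"
      using lmeasurable_compact[OF triangulation_element(1)[OF S]] Omega_lmeasurable
      by (intro sets.Int) auto
    obtain g c where gc: "\<forall>x\<in>S \<inter> Omega. u x = g \<bullet> x + c"
      using u S unfolding P1_zero_mean_def by blast
    have "(\<lambda>x. g \<bullet> x + c) absolutely_integrable_on cbox 0 1"
      by (intro absolutely_integrable_continuous continuous_intros)
    then have "(\<lambda>x. g \<bullet> x + c) absolutely_integrable_on (S \<inter> Omega)"
      by (rule set_integrable_subset[OF _ meas]) (use triangulation_element(4)[OF S] in auto)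
    then show "u absolutely_integrable_on (S \<inter> Omega)"
      using gc by (subst set_integrable_cong[OF refl refl, of _ _ "\<lambda>x. g \<bullet> x + c"]) auto
  qed
  moreover have "(\<Union>S\<in>\<T>. S \<inter> Omega) = Omega"
    using Omega_subset_Union by auto
  ultimately show ?thesis by simp
qed

section \<open>The stiffness form and its definiteness\<close>

context
  fixes \<phi> :: "'m::finite \<Rightarrow> real ^ 'd \<Rightarrow> real"
  assumes \<phi>: "\<And>p. \<phi> p \<in> P1_zero_mean \<T>"
begin

text \<open>The form is the Dirichlet energy over \<open>X\<close> of the function with coefficients
  \<open>v\<close>. The gradients are summed, which avoids computing \<open>grad\<close> of the
  sum.\<close>

lemma stiffness_form:
  assumes X: "X \<in> lmeasurable" "X \<subseteq> cbox 0 1"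
  shows "v \<bullet> (stiffness X \<phi> *v v) = integral X (\<lambda>x. (norm (\<Sum>p\<in>UNIV. v $ p *\<^sub>R grad (\<phi> p) x))\<^sup>2)"
proof -
  have int: "(\<lambda>x. grad (\<phi> p) x \<bullet> grad (\<phi> q) x) absolutely_integrable_on X" for p q
  proof (rule integrable_piecewise_constant[OF X])
    fix S assume "S \<in> \<T>"
    then show "\<exists>c. \<forall>x\<in>interior S. grad (\<phi> p) x \<bullet> grad (\<phi> q) x = c"
      using P1_grad_constant[OF \<phi>, of S p] P1_grad_constant[OF \<phi>, of S q] by metis
  qed
  have int': "(\<lambda>x. c * (grad (\<phi> p) x \<bullet> grad (\<phi> q) x)) integrable_on X" for c p q
    by (intro integrable_on_mult_right set_lebesgue_integral_eq_integral(1)[OF int])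
  have "v \<bullet> (stiffness X \<phi> *v v)
      = (\<Sum>p\<in>UNIV. \<Sum>q\<in>UNIV. integral X (\<lambda>x. v $ p * v $ q * (grad (\<phi> p) x \<bullet> grad (\<phi> q) x)))"
    by (simp add: inner_vec_def[of v] matrix_vector_mult_def stiffness_def sum_distrib_left
        set_lebesgue_integral_eq_integral(2)[OF int] mult_ac)
  also have "\<dots> = integral X (\<lambda>x. \<Sum>p\<in>UNIV. \<Sum>q\<in>UNIV. v $ p * v $ q * (grad (\<phi> p) x \<bullet> grad (\<phi> q) x))"
    by (simp add: integral_sum integrable_sum int')
  also have "\<dots> = integral X (\<lambda>x. (norm (\<Sum>p\<in>UNIV. v $ p *\<^sub>R grad (\<phi> p) x))\<^sup>2)"
    by (simp add: power2_norm_eq_inner inner_sum_left inner_sum_right sum_distrib_left mult.assoc)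
      (simp add: inner_commute)
  finally show ?thesis .
qed

lemma stiffness_nonneg:
  assumes X: "X \<in> lmeasurable" "X \<subseteq> cbox 0 1"
  shows "0 \<le> v \<bullet> (stiffness X \<phi> *v v)"
  unfolding stiffness_form[OF X]
  \<comment> \<open>The \<open>integral\<close> of a non-integrable function is 0 by default, so the
    bound holds in both cases.\<close>
  by (cases "(\<lambda>x. (norm (\<Sum>p\<in>UNIV. v $ p *\<^sub>R grad (\<phi> p) x))\<^sup>2) integrable_on X")
    (auto simp: not_integrable_integral intro!: integral_nonneg)

text \<open>The integrand is nonnegative and constant inside the cell, so its integral over
  \<open>X\<close> dominates that constant times a positive measure. The conclusion thus reaches
  points of the cell outside \<open>X\<close> too.\<close>

lemma stiffness_zero:
  assumes X: "X \<in> lmeasurable" "X \<subseteq> cbox 0 1" and zero: "v \<bullet> (stiffness X \<phi> *v v) = 0"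
    and S: "S \<in> \<T>" and meet: "\<not> negligible (X \<inter> interior S)" and x: "x \<in> interior S"
  shows "(\<Sum>p\<in>UNIV. v $ p *\<^sub>R grad (\<phi> p) x) = 0"
proof -
  define h where "h x = (norm (\<Sum>p\<in>UNIV. v $ p *\<^sub>R grad (\<phi> p) x))\<^sup>2" for x
  have const: "\<exists>c. \<forall>x\<in>interior S. h x = c" if S: "S \<in> \<T>" for S
  proof -
    obtain c where "\<And>p. \<forall>x\<in>interior S. grad (\<phi> p) x = c p"
      using P1_grad_constant[OF \<phi> S] by metis
    then show ?thesis unfolding h_def by auto
  qed
  have meas: "X \<inter> interior S \<in> lmeasurable"
    using X(1) by (intro fmeasurable.Int lmeasurable_interior compact_imp_bounded
        triangulation_element(1)[OF S])
  have hc: "h y = h x" if "y \<in> interior S" for y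
    using const[OF S] that x by metis
  have "h x * measure lebesgue (X \<inter> interior S) = integral (X \<inter> interior S) (\<lambda>y. h x)"
    using lmeasure_integral[OF meas] integral_mult_right[of "X \<inter> interior S" "h x" "\<lambda>_. 1"] by simp
  also have "\<dots> = integral (X \<inter> interior S) h"
    by (rule integral_cong) (simp add: hc)
  also have "\<dots> \<le> integral X h"
  proof (rule integral_subset_le)
    show "h integrable_on X"
      by (rule set_lebesgue_integral_eq_integral(1)[OF integrable_piecewise_constant[OF X const]])
    show "h integrable_on X \<inter> interior S"
      using X(2) by (intro set_lebesgue_integral_eq_integral(1)
          integrable_piecewise_constant[OF meas _ const]) auto
  qed (auto simp: h_def)
  also have "\<dots> = 0" using zero by (simp add: stiffness_form[OF X] h_def[abs_def])
  finally have "h x * measure lebesgue (X \<inter> interior S) \<le> 0" .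
  moreover have "0 < measure lebesgue (X \<inter> interior S)"
    using meet meas by (simp add: negligible_iff_measure less_le)
  ultimately have "h x \<le> 0" by (simp add: mult_le_0_iff)
  then show ?thesis by (simp add: h_def)
qed

text \<open>Vanishing gradients make \<open>u\<close> constant on each cell, and finitely many cells
  give it a finite range. A continuous function with finite range on the connected cube is constant,
  which avoids any argument about neighbouring cells; zero mean and linear independence finish the
  proof.\<close>

lemma stiffness_definite:
  fixes T :: "'n::finite \<Rightarrow> (real ^ 'd) set"
  assumes basis: "is_basis_on_Omega (P1_zero_mean \<T>) \<phi>"
    and T: "\<And>i. T i \<in> lmeasurable" "(\<Union>i. T i) = cbox 0 1"
    and zero: "\<And>i. v \<bullet> (stiffness (T i) \<phi> *v v) = 0"
  shows "v = 0"
proof -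
  define u where "u x = (\<Sum>p\<in>UNIV. v $ p * \<phi> p x)" for x
  have "\<exists>c. \<forall>x\<in>S \<inter> Omega. u x = c" if S: "S \<in> \<T>" for S
  proof -
    obtain g c where gc: "\<And>p. \<forall>x\<in>S \<inter> Omega. \<phi> p x = g p \<bullet> x + c p"
      and g: "\<And>p. \<forall>x\<in>interior S. grad (\<phi> p) x = g p"
      using P1_grad_constant[OF \<phi> S] by metis
    \<comment> \<open>Finitely many sets cover the open cell, which has positive measure, so one of
      them meets it in positive measure.\<close>
    have "\<exists>i. \<not> negligible (T i \<inter> interior S)"
    proof (rule ccontr)
      assume "\<not> ?thesis"
      then have "negligible (\<Union>i. T i \<inter> interior S)" by (intro negligible_Union) auto
      moreover have "(\<Union>i. T i \<inter> interior S) = interior S"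
        using T(2) triangulation_element(4)[OF S] interior_subset[of S] by blast
      ultimately show False
        using open_not_negligible[OF open_interior triangulation_element(3)[OF S]] by simp
    qed
    then obtain i where i: "\<not> negligible (T i \<inter> interior S)" by blast
    obtain y where y: "y \<in> interior S" using triangulation_element(3)[OF S] by blast
    have Ti: "T i \<subseteq> cbox 0 1" using T(2) by blast
    have "(\<Sum>p\<in>UNIV. v $ p *\<^sub>R g p) = 0"
      using stiffness_zero[OF T(1) Ti zero S i y] g y by simp
    then have "(\<Sum>p\<in>UNIV. v $ p * (g p \<bullet> x)) = 0" for x
      by (metis (no_types, lifting) inner_scaleR_left inner_sum_left inner_zero_left sum.cong)
    then have "u x = (\<Sum>p\<in>UNIV. v $ p * c p)" if "x \<in> S \<inter> Omega" for x
      using gc that by (simp add: u_def algebra_simps sum.distrib)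
    then show ?thesis by blast
  qed
  then obtain c where c: "\<And>S x. S \<in> \<T> \<Longrightarrow> x \<in> S \<inter> Omega \<Longrightarrow> u x = c S" by metis
  have "u ` Omega \<subseteq> c ` \<T>"
  proof
    fix y assume "y \<in> u ` Omega"
    then obtain x where x: "x \<in> Omega" "y = u x" by blast
    then have "x \<in> \<Union>\<T>" using Omega_subset_Union by auto
    then obtain S where "S \<in> \<T>" "x \<in> S" by (rule UnionE)
    then show "y \<in> c ` \<T>" using c[of S x] x by auto
  qed
  then have "finite (u ` Omega)" using finite_triangulation finite_surj by blast
  moreover have "continuous_on Omega u"
    unfolding u_def using \<phi> by (intro continuous_intros) (auto simp: P1_zero_mean_def)
  moreover have "connected (Omega :: (real ^ 'd) set)"
    unfolding Omega_def by (intro convex_connected convex_box)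
  ultimately have "u constant_on Omega" by (intro continuous_finite_range_constant)
  then obtain k where k: "\<And>x. x \<in> Omega \<Longrightarrow> u x = k" by (auto simp: constant_on_def)
  have int: "\<phi> p integrable_on Omega" for p
    by (rule set_lebesgue_integral_eq_integral(1)[OF integrable_P1[OF \<phi>]])
  have "integral Omega u = (\<Sum>p\<in>UNIV. v $ p * integral Omega (\<phi> p))"
    unfolding u_def
    by (subst integral_sum) (auto intro!: integrable_on_mult_right int)
  also have "\<dots> = 0"
    using \<phi> set_lebesgue_integral_eq_integral(2)[OF integrable_P1[OF \<phi>]]
    by (simp add: P1_zero_mean_def)
  finally have "integral Omega (\<lambda>x::real ^ 'd. k) = 0"
    using integral_cong[of Omega u "\<lambda>x. k"] k by simp
  then have "k * measure lebesgue (Omega :: (real ^ 'd) set) = 0"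
    using lmeasure_integral[OF Omega_lmeasurable]
      integral_mult_right[of "Omega :: (real ^ 'd) set" k "\<lambda>_. 1"] by simp
  moreover have "measure lebesgue (Omega :: (real ^ 'd) set) \<noteq> 0"
  proof -
    have "\<not> negligible (Omega :: (real ^ 'd) set)"
      unfolding Omega_def by (intro open_not_negligible open_box) (simp add: interval_ne_empty_cart)
    then show ?thesis by (simp add: negligible_iff_measure Omega_lmeasurable)
  qed
  ultimately have "\<forall>x\<in>Omega. (\<Sum>p\<in>UNIV. v $ p * \<phi> p x) = 0"
    using k by (simp add: u_def)
  then have "v $ p = 0" for p
    using basis unfolding is_basis_on_Omega_def by blast
  then show ?thesis by (simp add: vec_eq_iff)
qed

end

end

section \<open>The gradient flow of the discrete energy\<close>

theorem theorem4p1: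
  fixes f :: "real ^ 'd \<Rightarrow> real"
    and \<T> :: "nat \<Rightarrow> (real ^ 'd) set set"
    and \<delta> :: "nat \<Rightarrow> real"
    and n :: nat
    and T :: "'n::finite \<Rightarrow> (real ^ 'd) set"
    and \<phi> :: "'m::finite \<Rightarrow> real ^ 'd \<Rightarrow> real"
    and E :: "real ^ 'n \<Rightarrow> ereal"
    and \<mu>0 :: "real ^ 'n"
  assumes f_measurable: "f \<in> borel_measurable (lebesgue_on Omega)"
    and f_bounded: "\<exists>C. AE x in lebesgue_on Omega. \<bar>f x\<bar> \<le> C"
    and f_mean: "(LINT x:Omega|lebesgue. f x) = 0"
    and f_support: "compactly_contained (convex hull (ess_support f)) Omega"
    and triangulations: "\<And>k. triangulation_of_Omega (\<T> k)"
    and refinements: "\<And>k. uniform_refinement (\<T> k) (\<T> (Suc k))"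
    and T_enumerates: "bij_betw T UNIV (\<T> n)"
    and \<phi>_basis: "is_basis_on_Omega (P1_zero_mean (\<T> (Suc n))) \<phi>"
    and \<delta>_pos: "\<And>k. 0 < \<delta> k"
    and \<delta>_mono: "decseq \<delta>"
    and \<delta>_lim: "\<delta> \<longlonglongrightarrow> 0"
    and E_def: "E = energy (\<delta> n) f T \<phi>"
    and \<mu>0_nonneg: "\<mu>0 \<in> orthant"
    and \<mu>0_not_critical: "min_subgradient E \<mu>0 \<noteq> 0"
  shows "(\<exists>\<mu>. energy_solution E \<mu>0 \<mu> \<and>
              (\<forall>\<nu>. energy_solution E \<mu>0 \<nu> \<longrightarrow> (\<forall>t\<ge>0. \<nu> t = \<mu> t)))
       \<and> (\<forall>\<mu>. energy_solution E \<mu>0 \<mu> \<longrightarrow>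
              (AE t in lebesgue. 0 < t \<longrightarrow>
                 (\<mu> has_vector_derivative - min_subgradient E (\<mu> t)) (at t)))
       \<and> (\<forall>\<mu>. energy_solution E \<mu>0 \<mu> \<longrightarrow>
              (\<exists>l. (\<mu> \<longlongrightarrow> l) at_top \<and> is_arg_min E (\<lambda>\<nu>. \<nu> \<in> orthant) l))"
proof -
  \<comment> \<open>Weights live on the cells of \<open>\<T> n\<close>, basis functions on those of
    \<open>\<T> (Suc n)\<close>; the two are linked by the fact that the \<open>T i\<close> cover
    the cube.\<close>
  interpret compliance "\<lambda>i. stiffness (T i) \<phi>" "load_vector f \<phi>" "volumes T" "\<delta> n"
  proof
    have \<phi>: "\<phi> p \<in> P1_zero_mean (\<T> (Suc n))" for p
      using \<phi>_basis by (simp add: is_basis_on_Omega_def)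
    have T: "T i \<in> \<T> n" for i using T_enumerates by (auto simp: bij_betw_def)
    note cell = triangulation_element[OF triangulations[of n] T]
    have meas: "T i \<in> lmeasurable" for i by (rule lmeasurable_compact[OF cell(1)])
    show "u \<bullet> (stiffness (T i) \<phi> *v v) = v \<bullet> (stiffness (T i) \<phi> *v u)" for u v i
      by (rule stiffness_symmetric)
    show "0 \<le> v \<bullet> (stiffness (T i) \<phi> *v v)" for v i
      by (rule stiffness_nonneg[OF triangulations \<phi> meas cell(4)])
    have cover: "(\<Union>i. T i) = cbox 0 1"
      using T_enumerates Union_triangulation[OF triangulations[of n]] by (simp add: bij_betw_def)
    show "v = 0" if "\<And>i. v \<bullet> (stiffness (T i) \<phi> *v v) = 0" for v
      by (rule stiffness_definite[OF triangulations \<phi> \<phi>_basis meas cover that])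
    show "0 < \<delta> n" by (rule \<delta>_pos)
    show "0 < volumes T $ i" for i
      using cell(6)[of i] meas[of i] by (simp add: volumes_def negligible_iff_measure less_le)
  qed
  have "E \<mu> = (if \<mu> \<in> orthant then ereal (g \<mu>) else \<infinity>)" for \<mu>
    by (simp add: E_def energy_def g_def w_def A_def system_matrix_def)
  then interpret orthant_energy g G E "\<Sum>i\<in>UNIV. volumes T $ i + k * W\<^sup>2" "R * (R / \<alpha>)"
    "CARD('n) * (2 * k * W * (R / \<alpha>))"
    by (rule is_orthant_energy)
  obtain m where m: "m \<in> orthant" "\<And>\<nu>. \<nu> \<in> orthant \<Longrightarrow> g m \<le> g \<nu>"
    using minimizer_exists by blast
  obtain \<mu> where \<mu>: "energy_solution E \<mu>0 \<mu>"
    using energy_solution_exists[OF \<mu>0_nonneg] by blast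
  have "\<nu> t = \<mu> t" if "energy_solution E \<mu>0 \<nu>" "0 \<le> t" for \<nu> t
    by (rule energy_solution_unique[OF that(1) \<mu> that(2)])
  moreover have "AE t in lebesgue. 0 < t \<longrightarrow> (\<nu> has_vector_derivative - min_subgradient E (\<nu> t)) (at t)"
    if "energy_solution E \<mu>0 \<nu>" for \<nu>
    using that by (simp add: energy_solution_def solves_gradient_flow_def)
  moreover have "\<exists>l. (\<nu> \<longlongrightarrow> l) at_top \<and> is_arg_min E (\<lambda>\<nu>. \<nu> \<in> orthant) l"
    if "energy_solution E \<mu>0 \<nu>" for \<nu>
    by (rule energy_solution_converges[OF that m])
  ultimately show ?thesis using \<mu> by blast
qed

end
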